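(* Let $p$ be a prime. Let $w^{(1)},\ldots,w^{(\ell)}$ be pairwise distinct admissible words (elements of $W$) and let $k_1,\ldots,k_\ell$ be positive integers. For $j\ge 0$ let $c_j$ be the coefficient of the monomial $$X_{w^{(1)}}^{k_1}\cdots X_{w^{(\ell)}}^{k_\ell}$$ in the polynomial $P_j$. Then, as power series in $x$, $$\sum_{j\ge 0}c_jx^j=\frac{1}{k_1!}\bigl(\log r_{w^{(1)}}(x)\bigr)^{k_1}\cdots\frac{1}{k_\ell!}\bigl(\log r_{w^{(\ell)}}(x)\bigr)^{k_\ell}.$$
   Context: Fix a prime $p$. Digits are elements of $\{0,\ldots,p-1\}$. Words are written $w=w_{\mu-1}\cdots w_0$ with $w_{\mu-1}$ leftmost; $|w|=\mu$ is the length and $\varepsilon$ is the empty word. For a finite word $v=v_{\mu-1}\cdots v_0$ put $(v)_p=\sum_i v_ip^i$ (so $(\varepsilon)_p=0$). For a nonnegative integer $n$ with base-$p$ expansion $n=\sum_{i\ge 0}n_ip^i$ (padded with infinitely many zero digits) and a word $w$ of length $\mu$ containing a nonzero digit, $|n|_w=|\{i\ge 0: n_{i+\mu-1}\cdots n_i=w_{\mu-1}\cdots w_0\}|$ is the number of (possibly overlapping) occurrences of $w$ in the expansion of $n$. For $j,n\ge 0$, $\vartheta_p(j,n)=|\{t\in\{0,\ldots,n\}:\nu_p\binom nt=j\}|$, where $\nu_p(m)$ is the exponent of $p$ in $m$. The set $W$ of admissible words consists of all words $w_{\mu-1}\cdots w_0$ over $\{0,\ldots,p-1\}$ with $\mu\ge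 2$, $w_{\mu-1}\ne 0$, $w_0\ne p-1$. The set $\widetilde W$ consists of all words $w_{\mu-1}\cdots w_0$ with $\mu\ge 1$ and $w_{\mu-1}\neq 0$. For each $j\ge0$, $P_j$ denotes the polynomial in the variables $X_w$ ($w\in W$) such that $\vartheta_p(j,n)/\vartheta_p(0,n)=P_j\bigl((|n|_w)_{w\in W}\bigr)$ for all $n\ge 0$; such a polynomial exists and is unique. Define $T_n(x)=\sum_{j\ge0}\vartheta_p(j,n)x^j=\sum_{0\le t\le n}x^{\nu_p\binom nt}$ and $\overline T_n(x)=T_n(x)/\vartheta_p(0,n)$, so $\overline T_n(0)=1$. For a finite word $v$ put $\overline T_v=\overline T_{(v)_p}$. For $w\in\widetilde W\cup\{\varepsilon\}$, the left truncation $w_L$ and right truncation $w_R$ are defined by $\varepsilon_L=\varepsilon_R=\varepsilon$ and, for $w\in\widetilde W$: $w_L$ is the longest proper suffix $u$ of $w$ (i.e. ending at the rightmost letter) with $u\in\widetilde W\cup\{\varepsilon\}$, and $w_R$ is the longest proper prefix $u$ of $w$ (i.e. starting at the leftmost letter) with $u\in\widetilde W\cup\{\varepsilon\}$. One has $(w_L)_R=(w_R)_L$, denoted $w_{LR}$. For $w\in\widetilde W$ define the rational function $$r_w(x)=\frac{\overline T_w(x)\,\overline T_{w_{LR}}(x)}{\overline T_{w_R}(x)\,\overline T_{w_L}(x)},$$ which satisfies $r_w(0)=1$; $\log r_w(x)$ is understood as a power series at $0$ with zero constant term. *)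

theory Defs
  imports
    "HOL-Computational_Algebra.Computational_Algebra"
    "HOL-Library.Poly_Mapping"
    "HOL-Library.Sublist"
begin

text \<open>
  A word is a list of digits whose head is the leftmost (most significant) letter, so the letter
  \<open>w\<^sub>i\<close> of a word written as \<open>w\<^sub>\<mu>\<^sub>-\<^sub>1 \<dots> w\<^sub>0\<close> is \<open>rev w ! i\<close>.
\<close>

definition word_val :: "nat \<Rightarrow> nat list \<Rightarrow> nat" where
  "word_val p v = (\<Sum>i<length v. rev v ! i * p ^ i)"

definition digit :: "nat \<Rightarrow> nat \<Rightarrow> nat \<Rightarrow> nat" where
  "digit p n i = (n div p ^ i) mod p"

text \<open>
  The positions range over all of \<open>\<nat>\<close> (padding by zeros); the set is finite
  whenever \<open>w\<close> contains a nonzero digit.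
\<close>

definition occ :: "nat \<Rightarrow> nat list \<Rightarrow> nat \<Rightarrow> nat" where
  "occ p w n = card {i. \<forall>k<length w. digit p n (i + k) = rev w ! k}"

definition theta :: "nat \<Rightarrow> nat \<Rightarrow> nat \<Rightarrow> nat" where
  "theta p j n = card {t \<in> {0..n}. multiplicity p (n choose t) = j}"

definition adm_words :: "nat \<Rightarrow> nat list set" where
  "adm_words p = {w. set w \<subseteq> {0..p - 1} \<and> 2 \<le> length w \<and> hd w \<noteq> 0 \<and> last w \<noteq> p - 1}"

definition ext_words :: "nat \<Rightarrow> nat list set" where
  "ext_words p = {w. set w \<subseteq> {0..p - 1} \<and> 1 \<le> length w \<and> hd w \<noteq> 0}"

text \<open>
  A polynomial in variables indexed by \<open>'v\<close> is a finitely supported map from monomials to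
  coefficients, a monomial being a finitely supported map from variables to exponents.
\<close>

type_synonym ('v, 'a) mpoly = "('v \<Rightarrow>\<^sub>0 nat) \<Rightarrow>\<^sub>0 'a"

definition mpoly_vars :: "('v, 'a::zero) mpoly \<Rightarrow> 'v set" where
  "mpoly_vars P = (\<Union>m\<in>Poly_Mapping.keys P. Poly_Mapping.keys m)"

definition mpoly_eval :: "('v \<Rightarrow> 'a) \<Rightarrow> ('v, 'a::comm_semiring_1) mpoly \<Rightarrow> 'a" where
  "mpoly_eval x P = (\<Sum>m\<in>Poly_Mapping.keys P. Poly_Mapping.lookup P m *
     (\<Prod>v\<in>Poly_Mapping.keys m. x v ^ Poly_Mapping.lookup m v))"

definition P_poly :: "nat \<Rightarrow> nat \<Rightarrow> (nat list, rat) mpoly" where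
  "P_poly p j = (THE P. mpoly_vars P \<subseteq> adm_words p \<and>
     (\<forall>n. of_nat (theta p j n) / of_nat (theta p 0 n) = mpoly_eval (\<lambda>w. of_nat (occ p w n)) P))"

definition T_poly :: "nat \<Rightarrow> nat \<Rightarrow> rat poly" where
  "T_poly p n = (\<Sum>t\<in>{0..n}. monom 1 (multiplicity p (n choose t)))"

lemma coeff_T_poly: "coeff (T_poly p n) j = of_nat (theta p j n)"
proof -
  have "coeff (T_poly p n) j = (\<Sum>t\<in>{0..n}. if multiplicity p (n choose t) = j then 1 else 0)"
    unfolding T_poly_def by (simp add: coeff_sum)
  also have "\<dots> = of_nat (theta p j n)"
    unfolding theta_def by (subst sum.inter_filter [symmetric]) auto
  finally show ?thesis .
qed

definition T_bar :: "nat \<Rightarrow> nat \<Rightarrow> rat poly" where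
  "T_bar p n = smult (1 / of_nat (theta p 0 n)) (T_poly p n)"

lemma coeff_T_bar_0: "coeff (T_bar p n) 0 = 1"
proof -
  have "0 \<in> {t \<in> {0..n}. multiplicity p (n choose t) = 0}" by simp
  then have "theta p 0 n \<noteq> 0"
    unfolding theta_def by (subst card_0_eq) auto
  then show ?thesis by (simp add: T_bar_def coeff_T_poly)
qed

definition trunc_L :: "nat \<Rightarrow> nat list \<Rightarrow> nat list" where
  "trunc_L p w = (if w = [] then []
     else ARG_MAX length u. strict_suffix u w \<and> u \<in> ext_words p \<union> {[]})"

definition trunc_R :: "nat \<Rightarrow> nat list \<Rightarrow> nat list" where
  "trunc_R p w = (if w = [] then []
     else ARG_MAX length u. strict_prefix u w \<and> u \<in> ext_words p \<union> {[]})"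

definition T_word :: "nat \<Rightarrow> nat list \<Rightarrow> rat fps" where
  "T_word p v = fps_of_poly (T_bar p (word_val p v))"

lemma T_word_nth_0: "fps_nth (T_word p v) 0 = 1"
  by (simp add: T_word_def coeff_T_bar_0)

text \<open>
  The power series expansion at \<open>0\<close> of the rational function \<open>r\<^sub>w\<close>; the denominator
  has constant term \<open>1\<close>.
\<close>

definition r_word :: "nat \<Rightarrow> nat list \<Rightarrow> rat fps" where
  "r_word p w = (T_word p w * T_word p (trunc_R p (trunc_L p w))) /
     (T_word p (trunc_R p w) * T_word p (trunc_L p w))"

lemma r_word_nth_0: "fps_nth (r_word p w) 0 = 1"
  by (simp add: r_word_def fps_divide_unit T_word_nth_0)

text \<open>
  \<^term>\<open>fps_ln 1\<close> is the series of \<open>log (1 + x)\<close>, so this is the logarithm of a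
  series \<open>f\<close> with constant term \<open>1\<close>.
\<close>

definition fps_log :: "rat fps \<Rightarrow> rat fps" where
  "fps_log f = fps_compose (fps_ln 1) (f - 1)"

end

theory Submission
  imports Defs
begin

text \<open>
  Counting borrows gives \<open>T\<^sub>p\<^sub>n\<^sub>+\<^sub>a\<close> as a linear combination of \<open>T\<^sub>n\<close> and a companion \<open>S\<^sub>n\<close>; every digit
  acts on the pair \<open>(T, S)\<close> by a matrix of determinant \<open>p x\<close>. Hence, for a word \<open>d u e\<close>, the
  \<open>2 \<times> 2\<close> minor \<open>T\<^sub>d\<^sub>u\<^sub>e T\<^sub>u - T\<^sub>d\<^sub>u T\<^sub>u\<^sub>e\<close> is \<open>(p - e - 1) d x (p x)\<^sup>|\<^sup>u\<^sup>|\<close>: so \<open>r\<^sub>w = 1\<close> for words which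
  are not admissible, and \<open>r\<^sub>w = 1 + O(x\<^sup>|\<^sup>w\<^sup>|\<^sup>-\<^sup>1)\<close>. The product of \<open>r\<^sub>w\<close> over all factors \<open>w\<close> of the
  expansion of \<open>n\<close> telescopes to the normalised \<open>T\<^sub>n\<close>; expanding it as
  \<open>exp (\<Sum>\<^sub>w |n|\<^sub>w log r\<^sub>w)\<close> yields polynomials with the stated coefficients. They are the only
  ones: the occurrence vectors of the multiples of \<open>p\<^sup>L\<close>, restricted to words of length at most
  \<open>L\<close>, form an additive monoid in which every vector of natural numbers is a difference.
\<close>

section \<open>Binomial coefficients and the recurrence for T and S\<close>

lemma multiplicity_prime_mult:
  assumes "prime (p::nat)" "m > 0"
  shows "multiplicity p (p * m) = Suc (multiplicity p m)"
  using assms by (simp add: prime_elem_multiplicity_mult_distrib)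

text \<open>One step of Legendre's formula: of the factors of the factorial only p, 2p, ..., np are
  divisible by p, and taking one p out of each leaves n!.\<close>

lemma multiplicity_fact_prime_mult_add:
  assumes p: "prime (p::nat)" and "a < p"
  shows "multiplicity p (fact (p * n + a)) = n + multiplicity p (fact n :: nat)"
  using \<open>a < p\<close>
proof (induction n arbitrary: a)
  case 0
  have "\<not> p dvd fact a" using 0 p by (simp add: prime_dvd_fact_iff)
  then show ?case by (simp add: not_dvd_imp_multiplicity_0)
next
  case (Suc n)
  from \<open>a < p\<close> show ?case
  proof (induction a)
    case 0
    obtain q where q: "p = Suc q" using p prime_gt_0_nat gr0_implies_Suc by blast
    \<comment> \<open>Here q = p - 1, so compared with the factorial of p n + q the only new factor
      is p (n + 1).\<close>
    have "fact (p * Suc n + 0) = p * Suc n * (fact (p * n + q) :: nat)"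
      using fact_Suc[of "p * n + q", where 'a = nat] by (simp add: q algebra_simps)
    also have "multiplicity p \<dots> = multiplicity p (p * Suc n) + multiplicity p (fact (p * n + q) :: nat)"
      using p by (intro prime_elem_multiplicity_mult_distrib) auto
    also have "multiplicity p (p * Suc n) = Suc (multiplicity p (Suc n))"
      using p by (rule multiplicity_prime_mult) simp
    also have "multiplicity p (fact (p * n + q) :: nat) = n + multiplicity p (fact n :: nat)"
      using q by (intro Suc.IH) simp
    also have "Suc (multiplicity p (Suc n)) + (n + multiplicity p (fact n :: nat)) =
        Suc n + multiplicity p (fact (Suc n) :: nat)"
      using p by (simp add: prime_elem_multiplicity_mult_distrib del: mult_Suc)
    finally show ?case .
  next
    case (Suc a)
    have "\<not> p dvd p * Suc n + Suc a"
      using Suc.prems by (metis dvd_add_right_iff dvd_triv_left nat_dvd_not_less zero_less_Suc)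
    then have "multiplicity p (p * Suc n + Suc a) = 0"
      by (rule not_dvd_imp_multiplicity_0)
    moreover have "fact (p * Suc n + Suc a) = (p * Suc n + Suc a) * (fact (p * Suc n + a) :: nat)"
      by (metis fact_Suc add_Suc_right of_nat_id)
    moreover have "multiplicity p ((p * Suc n + Suc a) * (fact (p * Suc n + a) :: nat)) =
        multiplicity p (p * Suc n + Suc a) + multiplicity p (fact (p * Suc n + a) :: nat)"
      using p by (intro prime_elem_multiplicity_mult_distrib) auto
    ultimately show ?case
      using Suc by simp
  qed
qed

lemma multiplicity_fact_binomial:
  assumes "prime (p::nat)" "k \<le> n"
  shows "multiplicity p (fact n :: nat) =
    multiplicity p (n choose k) + multiplicity p (fact k :: nat) + multiplicity p (fact (n - k) :: nat)"
proof -
  have "(fact n :: nat) = (n choose k) * fact k * fact (n - k)"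
    using binomial_fact_lemma[OF \<open>k \<le> n\<close>] by (simp add: mult_ac)
  then show ?thesis
    using assms by (simp add: prime_elem_multiplicity_mult_distrib)
qed

text \<open>Since s \<le> a, the difference has upper part n - t and last digit a - s. The exponents
  n, t and n - t gained by the three factorials cancel.\<close>

lemma multiplicity_binomial_no_borrow:
  assumes p: "prime (p::nat)" and "a < p" "s \<le> a" "t \<le> n"
  shows "multiplicity p ((p * n + a) choose (p * t + s)) = multiplicity p (n choose t)"
proof -
  have le: "p * t + s \<le> p * n + a" using assms by (simp add: add_le_mono)
  have "p * n + a - (p * t + s) = p * (n - t) + (a - s)"
    using assms by (auto simp: algebra_simps diff_mult_distrib2)
  then show ?thesis
    using multiplicity_fact_binomial[OF p le] multiplicity_fact_binomial[OF p \<open>t \<le> n\<close>] assms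
      multiplicity_fact_prime_mult_add[OF p, of "a - s" "n - t"]
    by (simp add: multiplicity_fact_prime_mult_add)
qed

text \<open>Since s > a, the difference has upper part n - 1 - t and last digit p + a - s. The gains
  n, t and n - 1 - t leave one factor p over, and the remaining quotient n! / (t! (n - 1 - t)!) is n
  times a binomial coefficient.\<close>

lemma multiplicity_binomial_borrow:
  assumes p: "prime (p::nat)" and "s < p" "a < s" "t < n"
  shows "multiplicity p ((p * n + a) choose (p * t + s)) =
    Suc (multiplicity p (n * ((n - 1) choose t)))"
proof -
  have *: "p * n = p * (n - 1 - t) + p * t + p"
    using \<open>t < n\<close> by (metis Suc_diff_1 add.commute add_diff_inverse_nat diff_Suc_eq_diff_pred distrib_left
        less_Suc_eq_le mult_Suc_right not_less gr_implies_not0 neq0_conv less_imp_le_nat not_less_eq_eq)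
  have le: "p * t + s \<le> p * n + a" and le': "t \<le> n - 1" using assms * by auto
  have diff: "p * n + a - (p * t + s) = p * (n - 1 - t) + (p + a - s)"
    using assms * by auto
  have pas: "p + a - s < p" using assms by auto
  have "multiplicity p (fact n :: nat) = multiplicity p n + multiplicity p (fact (n - 1) :: nat)"
    using assms by (simp add: fact_reduce prime_elem_multiplicity_mult_distrib)
  moreover have "multiplicity p (n * ((n - 1) choose t)) = multiplicity p n + multiplicity p ((n - 1) choose t)"
    using assms le' by (subst prime_elem_multiplicity_mult_distrib) auto
  ultimately show ?thesis
    using multiplicity_fact_binomial[OF p le] multiplicity_fact_binomial[OF p le']
      multiplicity_fact_prime_mult_add[OF p pas, of "n - 1 - t"]
      multiplicity_fact_prime_mult_add[OF p, of a n] multiplicity_fact_prime_mult_add[OF p, of s t]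
      assms(2-4)
    unfolding diff by linarith
qed

text \<open>The indices are grouped as p t + s: those with s \<le> a, which need no borrow, run up
  to t = n, the others stop at t = n - 1.\<close>

lemma sum_atMost_base_digit:
  fixes g :: "nat \<Rightarrow> 'a::comm_monoid_add"
  assumes "a < p"
  shows "(\<Sum>t\<in>{0..p * n + a}. g t) =
    (\<Sum>t\<le>n. \<Sum>s\<le>a. g (p * t + s)) + (\<Sum>t<n. \<Sum>s\<in>{a<..<p}. g (p * t + s))"
proof -
  have inner: "(\<Sum>s\<in>{m * p..<m * p + p}. g s) =
      (\<Sum>s\<le>a. g (p * m + s)) + (\<Sum>s\<in>{a<..<p}. g (p * m + s))" for m
  proof -
    have "(\<Sum>s\<in>{m * p..<m * p + p}. g s) = (\<Sum>s\<in>{..a} \<union> {a<..<p}. g (p * m + s))"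
      using assms
      by (intro sum.reindex_bij_witness[of _ "\<lambda>s. p * m + s" "\<lambda>s. s - p * m"])
        (auto simp: mult.commute)
    then show ?thesis by (simp add: sum.union_disjoint disjoint_iff)
  qed
  have "{0..p * n + a} = {..<n * p} \<union> {n * p..n * p + a}"
    using assms by (auto simp: mult.commute)
  then have "(\<Sum>t\<in>{0..p * n + a}. g t) = (\<Sum>t<n * p. g t) + (\<Sum>t\<in>{n * p..n * p + a}. g t)"
    by (simp only:) (rule sum.union_disjoint, auto)
  also have "(\<Sum>t\<in>{n * p..n * p + a}. g t) = (\<Sum>s\<le>a. g (p * n + s))"
    by (intro sum.reindex_bij_witness[of _ "\<lambda>s. p * n + s" "\<lambda>s. s - p * n"])
      (auto simp: mult.commute)
  also have "(\<Sum>t<n * p. g t) = (\<Sum>m<n. sum g {m * p..<m * p + p})"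
    by (simp add: sum.nat_group)
  also have "\<dots> = (\<Sum>m<n. \<Sum>s\<le>a. g (p * m + s)) + (\<Sum>m<n. \<Sum>s\<in>{a<..<p}. g (p * m + s))"
    by (simp add: inner sum.distrib)
  finally show ?thesis
    by (simp add: lessThan_Suc_atMost[symmetric] add_ac)
qed

text \<open>The generating polynomial of what a borrow leaves behind: the valuations of n! / (t! (n
  - 1 - t)!).\<close>

definition S_poly :: "nat \<Rightarrow> nat \<Rightarrow> rat poly" where
  "S_poly p n = (\<Sum>t<n. monom 1 (multiplicity p (n * ((n - 1) choose t))))"

text \<open>For each t the a + 1 last digits s \<le> a leave the valuation unchanged, while the p -
  a - 1 larger ones cause a borrow, hence a factor x.\<close>

lemma T_poly_rec:
  assumes p: "prime p" and a: "a < p"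
  shows "T_poly p (p * n + a) =
    of_nat (a + 1) * T_poly p n + of_nat (p - a - 1) * monom 1 1 * S_poly p n"
proof -
  have "T_poly p (p * n + a) =
      (\<Sum>t\<le>n. \<Sum>s\<le>a. monom 1 (multiplicity p (n choose t))) +
      (\<Sum>t<n. \<Sum>s\<in>{a<..<p}. monom 1 1 * monom 1 (multiplicity p (n * ((n - 1) choose t))))"
    unfolding T_poly_def sum_atMost_base_digit[OF a]
    using multiplicity_binomial_no_borrow[OF p a] multiplicity_binomial_borrow[OF p]
    by (intro arg_cong2[of _ _ _ _ "(+)"] sum.cong refl) (auto simp: mult_monom)
  also have "\<dots> = of_nat (a + 1) * T_poly p n + of_nat (p - a - 1) * monom 1 1 * S_poly p n"
    by (simp add: T_poly_def S_poly_def sum_distrib_left atMost_atLeast0 mult_ac)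
  finally show ?thesis .
qed

text \<open>For a > 0 the factor p n + a is prime to p, so S at p n + a is T at p n + a - 1. For a =
  0 the number p n - 1 ends in the digit p - 1, so no borrow occurs, and the factor p n supplies the
  x.\<close>

lemma S_poly_rec:
  assumes p: "prime p" and a: "a < p"
  shows "S_poly p (p * n + a) =
    of_nat a * T_poly p n + of_nat (p - a) * monom 1 1 * S_poly p n"
proof (cases a)
  case (Suc b)
  have "\<not> p dvd p * n + Suc b"
    using a Suc by (metis dvd_add_right_iff dvd_triv_left nat_dvd_not_less zero_less_Suc)
  then have 0: "multiplicity p (Suc (p * n + b)) = 0"
    by (simp add: not_dvd_imp_multiplicity_0)
  have "S_poly p (p * n + a) = (\<Sum>t\<in>{0..p * n + b}. monom 1 (multiplicity p ((p * n + b) choose t)))"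
    unfolding S_poly_def using Suc p 0
    by (intro sum.cong) (auto simp: prime_elem_multiplicity_mult_distrib simp del: mult_Suc)
  also have "\<dots> = T_poly p (p * n + b)" by (simp add: T_poly_def)
  also have "\<dots> = of_nat (b + 1) * T_poly p n + of_nat (p - b - 1) * monom 1 1 * S_poly p n"
    using Suc a by (intro T_poly_rec p) auto
  finally show ?thesis using Suc by simp
next
  case 0
  show ?thesis
  proof (cases n)
    case (Suc m)
    obtain q where q: "p = Suc q" using p prime_gt_0_nat gr0_implies_Suc by blast
    have eq: "multiplicity p (p * n * ((p * n - 1) choose (p * t + s))) =
        Suc (multiplicity p (n * ((n - 1) choose t)))" if "t \<le> m" "s \<le> q" for t s
    proof -
      have pn: "p * n - 1 = p * m + q" using Suc q by simp
      have 1: "multiplicity p ((p * m + q) choose (p * t + s)) = multiplicity p (m choose t)"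
        using that q by (intro multiplicity_binomial_no_borrow p) auto
      have "p * t + s \<le> p * m + q" using that by (simp add: add_le_mono)
      then have ne: "((p * m + q) choose (p * t + s)) \<noteq> 0" "(m choose t) \<noteq> 0" "n \<noteq> 0" "p \<noteq> 0"
        using that Suc q by auto
      show ?thesis
        using p ne 1 multiplicity_prime_mult[OF p, of n] unfolding pn
        by (simp add: prime_elem_multiplicity_mult_distrib Suc del: mult_Suc mult_Suc_right)
    qed
    have "{..<p * n} = {0..p * m + q}" using Suc q by auto
    then have "S_poly p (p * n) =
        (\<Sum>t\<in>{0..p * m + q}. monom 1 (multiplicity p (p * n * ((p * n - 1) choose t))))"
      by (simp add: S_poly_def)
    also have "\<dots> = (\<Sum>t\<le>m. \<Sum>s\<le>q. monom 1 (multiplicity p (p * n * ((p * n - 1) choose (p * t + s)))))"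
    proof -
      have "q < p" "{q<..<p} = {}" using q by auto
      then show ?thesis by (simp only: sum_atMost_base_digit sum.empty sum.neutral_const add_0_right)
    qed
    also have "\<dots> = (\<Sum>t\<le>m. \<Sum>s\<le>q. monom 1 1 * monom 1 (multiplicity p (n * ((n - 1) choose t))))"
      by (intro sum.cong refl) (simp only: atMost_iff eq mult_monom, simp)
    also have "\<dots> = of_nat p * monom 1 1 * S_poly p n"
      using q by (simp add: S_poly_def Suc lessThan_Suc_atMost sum_distrib_left mult.assoc)
    finally show ?thesis using 0 by simp
  qed (simp add: 0 S_poly_def)
qed

lemma T_poly_0 [simp]: "T_poly p 0 = 1"
  by (simp add: T_poly_def)

lemma S_poly_0 [simp]: "S_poly p 0 = 0"
  by (simp add: S_poly_def)

text \<open>The term with S carries a factor x, so the constant coefficients of T satisfy a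
  recurrence of their own.\<close>

lemma theta_0_rec:
  assumes "prime p" "a < p"
  shows "theta p 0 (p * n + a) = (a + 1) * theta p 0 n"
proof -
  have "coeff (T_poly p (p * n + a)) 0 = coeff (of_nat (a + 1) * T_poly p n) 0"
    by (simp only: T_poly_rec[OF assms]) (simp add: coeff_mult_0 coeff_monom)
  then have "(of_nat (theta p 0 (p * n + a)) :: rat) = of_nat ((a + 1) * theta p 0 n)"
    by (simp add: coeff_mult_0 coeff_T_poly of_nat_poly algebra_simps)
  then show ?thesis by (simp only: of_nat_eq_iff)
qed

section \<open>Second differences along words\<close>

lemma word_val_Nil [simp]: "word_val p [] = 0"
  by (simp add: word_val_def)

lemma word_val_snoc [simp]: "word_val p (v @ [e]) = p * word_val p v + e"
  unfolding word_val_def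
  by (simp add: sum.lessThan_Suc_shift sum_distrib_left mult_ac del: sum.lessThan_Suc)

lemma word_val_Cons: "word_val p (d # v) = d * p ^ length v + word_val p v"
  unfolding word_val_def by (simp add: nth_append)

lemma word_val_dropWhile_0: "word_val p (dropWhile ((=) 0) v) = word_val p v"
  by (induction v) (auto simp: word_val_Cons)

text \<open>The last letter e acts on both pairs (T, S) by the matrix with rows (e + 1, (p - e - 1)
  x) and (e, (p - e) x), of determinant p x. The initial minor is -d, as T_d = d + 1, S_d = d, T_0 =
  1 and S_0 = 0.\<close>

lemma T_S_poly_det:
  assumes p: "prime p" and d: "d < p" and u: "set u \<subseteq> {..<p}"
  shows "T_poly p (word_val p (d # u)) * S_poly p (word_val p u) -
      S_poly p (word_val p (d # u)) * T_poly p (word_val p u) =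
    - (of_nat d * (of_nat p * monom 1 1) ^ length u)"
  using u
proof (induction u rule: rev_induct)
  case Nil
  show ?case
    using T_poly_rec[OF p d, of 0] S_poly_rec[OF p d, of 0] by (simp add: word_val_Cons)
next
  case (snoc e u)
  then have e: "e < p" by simp
  \<comment> \<open>Expressing p - e and p - e - 1 by c frees the identity of truncated
    subtraction.\<close>
  then obtain c where c: "p = e + c + 1" using less_imp_Suc_add by fastforce
  then have pe: "p - e = c + 1" "c + 1 - 1 = c" by auto
  let ?T1 = "T_poly p (word_val p (d # u))" and ?S1 = "S_poly p (word_val p (d # u))"
  let ?T2 = "T_poly p (word_val p u)" and ?S2 = "S_poly p (word_val p u)"
  have val: "word_val p (d # u @ [e]) = p * word_val p (d # u) + e"
    using word_val_snoc[of p "d # u" e] by simp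
  have "T_poly p (word_val p (d # u @ [e])) * S_poly p (word_val p (u @ [e])) -
      S_poly p (word_val p (d # u @ [e])) * T_poly p (word_val p (u @ [e])) =
      of_nat (e + c + 1) * monom 1 1 * (?T1 * ?S2 - ?S1 * ?T2)"
    unfolding val word_val_snoc T_poly_rec[OF p e] S_poly_rec[OF p e] pe of_nat_add of_nat_1
    by (simp add: algebra_simps)
  also have "\<dots> = of_nat p * monom 1 1 * - (of_nat d * (of_nat p * monom 1 1) ^ length u)"
    using snoc unfolding c[symmetric] by simp
  finally show ?case by simp
qed

text \<open>After the recurrence for the last letter e, the terms T T cancel and the mixed terms are
  -(p - e - 1) x times the minor of \<open>T_S_poly_det\<close>.\<close>

lemma T_poly_second_difference:
  assumes p: "prime p" and d: "d < p" and u: "set u \<subseteq> {..<p}" and e: "e < p"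
  shows "T_poly p (word_val p (d # u @ [e])) * T_poly p (word_val p u) -
      T_poly p (word_val p (d # u)) * T_poly p (word_val p (u @ [e])) =
    of_nat (p - e - 1) * monom 1 1 * of_nat d * (of_nat p * monom 1 1) ^ length u"
proof -
  let ?T1 = "T_poly p (word_val p (d # u))" and ?S1 = "S_poly p (word_val p (d # u))"
  let ?T2 = "T_poly p (word_val p u)" and ?S2 = "S_poly p (word_val p u)"
  have val: "word_val p (d # u @ [e]) = p * word_val p (d # u) + e"
    using word_val_snoc[of p "d # u" e] by simp
  have "T_poly p (word_val p (d # u @ [e])) * ?T2 - ?T1 * T_poly p (word_val p (u @ [e])) =
      - (of_nat (p - e - 1) * monom 1 1 * (?T1 * ?S2 - ?S1 * ?T2))"
    unfolding val word_val_snoc T_poly_rec[OF p e] by algebra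
  then show ?thesis unfolding T_S_poly_det[OF p d u] by (simp add: mult_ac)
qed

text \<open>Appending e multiplies \<open>theta p 0\<close> by e + 1 whatever stands before it, so
  both products have the same normalising constant. The coefficient c vanishes in the two cases
  where d u e fails to be admissible.\<close>

lemma T_word_second_difference:
  assumes p: "prime p" and d: "d < p" and u: "set u \<subseteq> {..<p}" and e: "e < p"
  shows "\<exists>c. T_word p (d # u @ [e]) * T_word p u =
      T_word p (d # u) * T_word p (u @ [e]) + fps_const c * fps_X ^ (length u + 1) \<and>
    (d = 0 \<or> e = p - 1 \<longrightarrow> c = 0)"
proof -
  define c0 where "c0 = (of_nat (p - e - 1) * of_nat d * of_nat p ^ length u :: rat)"
  define \<theta> where "\<theta> v = (of_nat (theta p 0 (word_val p v)) :: rat)" for v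
  have T_bar: "T_bar p (word_val p v) = smult (1 / \<theta> v) (T_poly p (word_val p v))" for v
    by (simp add: T_bar_def \<theta>_def)
  have T_bar_mult: "T_bar p (word_val p v) * T_bar p (word_val p v') =
      smult (1 / (\<theta> v * \<theta> v')) (T_poly p (word_val p v) * T_poly p (word_val p v'))" for v v'
    by (simp add: T_bar mult.commute)
  have \<theta>_snoc: "\<theta> (v @ [e]) = of_nat (e + 1) * \<theta> v" for v
    by (simp add: \<theta>_def theta_0_rec[OF p e] distrib_right)
  have \<theta>: "\<theta> (d # u @ [e]) * \<theta> u = \<theta> (d # u) * \<theta> (u @ [e])"
    using \<theta>_snoc[of "d # u"] \<theta>_snoc[of u] by simp
  define c where "c = c0 / (\<theta> (d # u @ [e]) * \<theta> u)"
  have "T_poly p (word_val p (d # u @ [e])) * T_poly p (word_val p u) =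
      T_poly p (word_val p (d # u)) * T_poly p (word_val p (u @ [e])) + smult c0 (monom 1 1 ^ (length u + 1))"
  proof -
    have "of_nat (p - e - 1) * monom 1 1 * of_nat d * (of_nat p * monom 1 1) ^ length u =
        smult c0 (monom 1 1 ^ (length u + 1))"
      by (simp add: c0_def of_nat_poly smult_power mult_ac)
    then show ?thesis using T_poly_second_difference[OF assms] by (simp add: algebra_simps)
  qed
  then have "smult (1 / (\<theta> (d # u @ [e]) * \<theta> u))
        (T_poly p (word_val p (d # u @ [e])) * T_poly p (word_val p u)) =
      smult (1 / (\<theta> (d # u @ [e]) * \<theta> u))
        (T_poly p (word_val p (d # u)) * T_poly p (word_val p (u @ [e]))) +
      smult c (monom 1 1 ^ (length u + 1))"
    by (simp add: smult_add_right c_def)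
  then have "T_bar p (word_val p (d # u @ [e])) * T_bar p (word_val p u) =
      T_bar p (word_val p (d # u)) * T_bar p (word_val p (u @ [e])) + smult c (monom 1 1 ^ (length u + 1))"
    by (simp only: T_bar_mult \<theta>)
  then have "fps_of_poly (T_bar p (word_val p (d # u @ [e])) * T_bar p (word_val p u)) =
      fps_of_poly (T_bar p (word_val p (d # u)) * T_bar p (word_val p (u @ [e])) + smult c (monom 1 1 ^ (length u + 1)))"
    by simp
  then have "T_word p (d # u @ [e]) * T_word p u =
      T_word p (d # u) * T_word p (u @ [e]) + fps_const c * fps_X ^ (length u + 1)"
    by (simp add: T_word_def fps_of_poly_mult fps_of_poly_add fps_of_poly_smult fps_of_poly_power
        fps_of_poly_monom')
  moreover have "d = 0 \<or> e = p - 1 \<longrightarrow> c = 0"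
    by (auto simp: c_def c0_def)
  ultimately show ?thesis by blast
qed

lemma arg_max_unique:
  fixes f :: "'a \<Rightarrow> nat"
  assumes "P k" "\<And>x. P x \<Longrightarrow> x \<noteq> k \<Longrightarrow> f x < f k"
  shows "arg_max f P = k"
  by (rule arg_maxI[of P k f "\<lambda>x. x = k"]) (use assms in \<open>force simp: not_less\<close>)+

section \<open>Truncations\<close>

text \<open>Dropping the last letter keeps the nonzero leading digit unless nothing is left, so the
  longest proper prefix is already a candidate.\<close>

lemma trunc_R_eq_butlast:
  assumes "w \<in> ext_words p"
  shows "trunc_R p w = butlast w"
proof -
  let ?P = "\<lambda>u. strict_prefix u w \<and> u \<in> ext_words p \<union> {[]}"
  have "w \<noteq> []" using assms by (auto simp: ext_words_def)
  have "strict_prefix (butlast w) w"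
    using \<open>w \<noteq> []\<close> by (metis append_butlast_last_id strict_prefixI' prefix_snoc strict_prefix_def
        append_self_conv not_Cons_self2 prefixI)
  moreover have "butlast w \<in> ext_words p \<union> {[]}"
    using assms by (cases w) (auto simp: ext_words_def Suc_le_eq dest: in_set_butlastD)
  ultimately have P: "?P (butlast w)" by blast
  moreover have "length u < length (butlast w)" if "?P u" "u \<noteq> butlast w" for u
  proof -
    have "u = take (length u) w" using that by (auto simp: strict_prefix_def prefix_def)
    then have "length u \<noteq> length w - 1" using that(2) by (metis butlast_conv_take)
    moreover have "length u < length w" using that(1) prefix_length_less by blast
    ultimately show ?thesis by simp
  qed
  ultimately have "arg_max length ?P = butlast w"
    by (rule arg_max_unique)
  then show ?thesis using \<open>w \<noteq> []\<close> by (simp add: trunc_R_def)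
qed

text \<open>A nonempty candidate starts with a nonzero digit, so stripping the leading zeros of the
  tail never cuts into it.\<close>

lemma trunc_L_eq_dropWhile:
  assumes "w \<in> ext_words p"
  shows "trunc_L p w = dropWhile ((=) 0) (tl w)"
proof -
  let ?P = "\<lambda>u. strict_suffix u w \<and> u \<in> ext_words p \<union> {[]}"
  let ?v = "dropWhile ((=) 0) (tl w)"
  obtain d v where w: "w = d # v" using assms by (cases w) (auto simp: ext_words_def)
  have "suffix ?v v" by (simp add: w suffix_dropWhile)
  then have "strict_suffix ?v w"
    by (metis w suffix_ConsI suffix_order.dual_order.strict_iff_order suffix_length_le
        length_Cons not_less_eq_eq order_refl)
  moreover have "?v \<in> ext_words p \<union> {[]}"
  proof (cases "?v = []")
    case False
    then have "hd ?v \<noteq> 0" using hd_dropWhile[of "(=) 0" "tl w"] by auto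
    moreover have "set ?v \<subseteq> {0..p - 1}"
      using assms set_mono_suffix[OF \<open>suffix ?v v\<close>] by (auto simp: ext_words_def w)
    moreover have "1 \<le> length ?v" using False by (cases ?v) auto
    ultimately show ?thesis by (auto simp: ext_words_def)
  qed simp
  ultimately have P: "?P ?v" by blast
  have suf: "suffix u ?v" if u: "?P u" for u
  proof (cases "u = []")
    case False
    have "suffix u v" using u w by (auto simp: strict_suffix_def suffix_Cons)
    then obtain a where a: "v = a @ u" by (auto simp: suffix_def)
    have "dropWhile ((=) 0) u = u"
      using u False by (cases u) (auto simp: ext_words_def)
    then have "dropWhile ((=) 0) v = dropWhile ((=) 0) a @ u"
      unfolding a by (induction a) auto
    then show ?thesis by (simp add: w suffix_def)
  qed simp
  have "arg_max length ?P = ?v"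
  proof (rule arg_max_unique[where P = ?P])
    fix u assume "?P u" "u \<noteq> ?v"
    then have "strict_suffix u ?v" using suf by (simp add: strict_suffix_def)
    then show "length u < length ?v" by (rule suffix_length_less)
  qed (rule P)
  then show ?thesis using w by (simp add: trunc_L_def)
qed

text \<open>\<open>T_word\<close> depends on a word only through its value, so the leading zeros
  removed by the left truncation may be put back.\<close>

lemma r_word_eq:
  assumes p: "prime p" and w: "w = d # u @ [e]" "w \<in> ext_words p"
  shows "r_word p w = T_word p w * T_word p u / (T_word p (d # u) * T_word p (u @ [e]))"
proof -
  let ?v = "dropWhile ((=) 0) (u @ [e])"
  have digits: "e < p" "set u \<subseteq> {..<p}"
    using w prime_gt_0_nat[OF p] by (auto simp: ext_words_def less_eq_nat.simps Suc_le_eq)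
  have L: "trunc_L p w = ?v" using trunc_L_eq_dropWhile[OF w(2)] w(1) by simp
  have TL: "T_word p ?v = T_word p (u @ [e])"
    by (simp add: T_word_def word_val_dropWhile_0 del: word_val_snoc)
  have R: "trunc_R p w = d # u" using trunc_R_eq_butlast[OF w(2)] w(1) by simp
  \<comment> \<open>If \<open>?v\<close> is empty, u has value 0. Otherwise dropping the last
    letter, from \<open>?v\<close> as from u e, divides the common value by p.\<close>
  have "word_val p (trunc_R p ?v) = word_val p u"
  proof (cases "?v = []")
    case True
    then have "p * word_val p u + e = 0"
      using word_val_dropWhile_0[of p "u @ [e]"] by simp
    then have "word_val p u = 0" using prime_gt_0_nat[OF p] by simp
    then show ?thesis using True by (simp add: trunc_R_def)
  next
    case False
    have sub: "set ?v \<subseteq> set (u @ [e])" by (meson set_dropWhileD subsetI)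
    have "?v \<in> ext_words p"
      using False hd_dropWhile[of "(=) 0" "u @ [e]"] sub w
      by (cases ?v) (auto simp: ext_words_def)
    then have "trunc_R p ?v = butlast ?v" by (rule trunc_R_eq_butlast)
    moreover have "word_val p u = (p * word_val p u + e) div p" using digits by simp
    moreover have "p * word_val p u + e = p * word_val p (butlast ?v) + last ?v"
      using word_val_dropWhile_0[of p "u @ [e]"] word_val_snoc[of p "butlast ?v" "last ?v"] False
      by (metis append_butlast_last_id word_val_snoc)
    moreover have "last ?v < p"
      using False sub digits last_in_set[of ?v] by fastforce
    ultimately show ?thesis by simp
  qed
  then have "T_word p (trunc_R p ?v) = T_word p u" by (simp add: T_word_def)
  then show ?thesis by (simp add: r_word_def L R TL)
qed

section \<open>Logarithms of power series\<close>

lemma fps_exp_compose_fps_log: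
  assumes "fps_nth f 0 = 1"
  shows "fps_exp 1 oo fps_log f = f"
proof -
  have f0: "fps_nth (f - 1) 0 = 0" using assms by simp
  \<comment> \<open>The series exp(x) - 1 and log(1 + x) are inverse under composition.\<close>
  have "(fps_exp 1 - 1) oo fps_ln 1 = (fps_X :: rat fps)"
    using fps_inv_fps_exp_compose(2)[of "1::rat"] fps_ln_fps_exp_inv[of "1::rat"] by simp
  then have "fps_exp 1 oo fps_ln 1 = 1 + (fps_X :: rat fps)"
    by (simp add: fps_compose_sub_distrib algebra_simps)
  then have "fps_exp 1 oo fps_log f = (1 + fps_X) oo (f - 1)"
    using fps_compose_assoc[OF f0, of "fps_ln 1" "fps_exp 1"] by (simp add: fps_log_def)
  also have "\<dots> = f"
    using f0 by (simp add: fps_compose_add_distrib fps_X_fps_compose_startby0)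
  finally show ?thesis .
qed

lemma fps_log_nth_0 [simp]: "fps_nth (fps_log f) 0 = 0"
  by (simp add: fps_log_def)

lemma fps_power_nth_below:
  assumes "fps_nth (f :: 'a::comm_ring_1 fps) 0 = 0" "i < k"
  shows "fps_nth (f ^ k) i = 0"
  using assms startsby_zero_power_prefix by blast

text \<open>f^a = exp(a log f), and log f has no constant term, so powers of it beyond j do not
  reach coefficient i. The cut-off j does not depend on a, which makes the coefficients polynomial
  in a.\<close>

lemma fps_power_nth_eq_exp_log:
  assumes "fps_nth f 0 = 1" "i \<le> j"
  shows "fps_nth (f ^ a) i = fps_nth (\<Sum>k\<le>j. fps_const (1 / fact k) * fps_log f ^ k * of_nat a ^ k) i"
proof -
  have "f ^ a = fps_exp (of_nat a) oo fps_log f"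
    using fps_exp_compose_fps_log[OF assms(1)] fps_compose_power[of "fps_log f" "fps_exp 1" a]
    by (simp add: fps_exp_power_mult)
  then have "fps_nth (f ^ a) i = (\<Sum>k\<in>{0..i}. of_nat a ^ k / fact k * fps_nth (fps_log f ^ k) i)"
    by (simp add: fps_compose_nth)
  also have "\<dots> = (\<Sum>k\<le>j. of_nat a ^ k / fact k * fps_nth (fps_log f ^ k) i)"
    using assms(2) by (intro sum.mono_neutral_left) (auto simp: fps_power_nth_below)
  also have "\<dots> = fps_nth (\<Sum>k\<le>j. fps_const (1 / fact k) * fps_log f ^ k * of_nat a ^ k) i"
    by (simp add: fps_sum_nth fps_of_nat[symmetric] mult_ac del: fps_of_nat)
  finally show ?thesis .
qed

lemma fps_X_power_dvd_nth:
  assumes "fps_X ^ k dvd (f :: 'a::comm_ring_1 fps)" "i < k"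
  shows "fps_nth f i = 0"
  using assms by (auto simp: dvd_def fps_X_power_mult_nth)

text \<open>The series log(1 + x) is x times a power series, so log f is a multiple of f -
  1.\<close>

lemma fps_X_power_dvd_fps_log:
  assumes "fps_nth f 0 = 1" "fps_X ^ k dvd f - 1"
  shows "fps_X ^ k dvd fps_log f"
proof -
  have "fps_X dvd (fps_ln 1 :: rat fps)" by simp
  then obtain g where g: "fps_ln 1 = fps_X * (g :: rat fps)" by (elim dvdE)
  have "fps_log f = (f - 1) * (g oo (f - 1))"
    using assms(1) by (simp add: fps_log_def g fps_compose_mult_distrib fps_X_fps_compose_startby0)
  then show ?thesis using assms(2) by simp
qed

section \<open>Order of vanishing of the logarithms of \<open>r_word\<close>\<close>

lemma adm_wordsE:
  assumes "w \<in> adm_words p" "prime p"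
  obtains d u e where "w = d # u @ [e]" "d \<noteq> 0" "e \<noteq> p - 1" "d < p" "e < p" "set u \<subseteq> {..<p}"
    "w \<in> ext_words p"
proof -
  obtain d v where w: "w = d # v" "v \<noteq> []"
    using assms by (cases w; cases "tl w") (auto simp: adm_words_def)
  then have "w = d # butlast v @ [last v]" by simp
  moreover have "{0..p - 1} = {..<p}" using prime_gt_0_nat[OF assms(2)] by auto
  then have "set w \<subseteq> {..<p}" using assms(1) by (simp add: adm_words_def)
  moreover have "w \<in> ext_words p" using assms by (auto simp: adm_words_def ext_words_def)
  moreover have "set (butlast v) \<subseteq> set w" "last v \<in> set w" "d \<in> set w"
    using w by (auto dest: in_set_butlastD)
  moreover have "d \<noteq> 0" "last v \<noteq> p - 1" using assms(1) w by (auto simp: adm_words_def)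
  ultimately show ?thesis
    using that[of d "butlast v" "last v"] by blast
qed

text \<open>Numerator and denominator of r_w differ by a multiple of x to the power |u| + 1 = |w| -
  1, and the denominator is a unit.\<close>

lemma fps_X_power_dvd_r_word:
  assumes p: "prime p" and w: "w \<in> adm_words p"
  shows "fps_X ^ (length w - 1) dvd r_word p w - 1"
proof -
  obtain d u e where w': "w = d # u @ [e]" "d < p" "e < p" "set u \<subseteq> {..<p}" "w \<in> ext_words p"
    using adm_wordsE[OF w p] by metis
  let ?D = "T_word p (d # u) * T_word p (u @ [e])"
  obtain c where c: "T_word p w * T_word p u = ?D + fps_const c * fps_X ^ (length u + 1)"
    using T_word_second_difference[OF p w'(2,4,3)] w'(1) by auto
  have D: "fps_nth ?D 0 \<noteq> 0" by (simp add: T_word_nth_0)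
  have "r_word p w = (?D + fps_const c * fps_X ^ (length u + 1)) * inverse ?D"
    unfolding r_word_eq[OF p w'(1,5)] c using D by (rule fps_divide_unit)
  also have "\<dots> = 1 + fps_X ^ (length u + 1) * (fps_const c * inverse ?D)"
    using inverse_mult_eq_1'[OF D] by (simp add: algebra_simps)
  finally show ?thesis by (simp add: w'(1))
qed

corollary fps_X_power_dvd_log_r_word:
  assumes "prime p" "w \<in> adm_words p"
  shows "fps_X ^ (length w - 1) dvd fps_log (r_word p w)"
  by (rule fps_X_power_dvd_fps_log[OF r_word_nth_0 fps_X_power_dvd_r_word[OF assms]])

section \<open>Factors of expansions and the telescoping product\<close>

text \<open>Position i belongs to the rightmost letter; the reversal puts the most significant digit
  at the head.\<close>

definition digit_word :: "nat \<Rightarrow> nat \<Rightarrow> nat \<Rightarrow> nat \<Rightarrow> nat list" where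
  "digit_word p n i m = rev (map (\<lambda>k. digit p n (i + k)) [0..<m])"

lemma length_digit_word [simp]: "length (digit_word p n i m) = m"
  by (simp add: digit_word_def)

lemma digit_word_Suc: "digit_word p n i (Suc m) = digit p n (i + m) # digit_word p n i m"
  by (simp add: digit_word_def)

lemma digit_word_Suc': "digit_word p n i (Suc m) = digit_word p n (Suc i) m @ [digit p n i]"
  by (simp add: digit_word_def map_upt_Suc del: upt_Suc)

lemma word_val_digit_word: "word_val p (digit_word p n i m) = (n div p ^ i) mod p ^ m"
proof (induction m)
  case (Suc m)
  have "(n div p ^ i) mod (p ^ m * p) = p ^ m * (n div p ^ i div p ^ m mod p) + (n div p ^ i) mod p ^ m"
    by (rule mod_mult2_eq)
  then show ?case
    by (simp add: digit_word_Suc word_val_Cons Suc digit_def div_mult2_eq power_add mult.commute)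
qed (simp add: digit_word_def)

lemma digit_less: "p > 0 \<Longrightarrow> digit p n i < p"
  by (simp add: digit_def)

lemma set_digit_word: "p > 0 \<Longrightarrow> set (digit_word p n i m) \<subseteq> {..<p}"
  by (auto simp: digit_word_def digit_less)

lemma digit_word_eq_iff:
  "digit_word p n i (length w) = w \<longleftrightarrow> (\<forall>k<length w. digit p n (i + k) = rev w ! k)"
proof -
  have "digit_word p n i (length w) = w \<longleftrightarrow> map (\<lambda>k. digit p n (i + k)) [0..<length w] = rev w"
    unfolding digit_word_def by (rule rev_swap)
  also have "\<dots> \<longleftrightarrow> (\<forall>k<length w. digit p n (i + k) = rev w ! k)"
    by (subst list_eq_iff_nth_eq) simp
  finally show ?thesis .
qed

lemma occ_eq_card_digit_word: "occ p w n = card {i. digit_word p n i (length w) = w}"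
  by (simp add: occ_def digit_word_eq_iff)

lemma occurrence_top_digit:
  assumes "digit_word p n i (length w) = w" "w \<noteq> []"
  shows "digit p n (i + (length w - 1)) = hd w"
proof -
  obtain m where m: "length w = Suc m" using assms(2) by (cases w) auto
  have "hd (digit_word p n i (Suc m)) = digit p n (i + m)" by (simp add: digit_word_Suc)
  then show ?thesis using assms(1) m by simp
qed

lemma digit_eq_0: "n < p ^ m \<Longrightarrow> m \<le> i \<Longrightarrow> digit p n i = 0"
proof (cases "p = 0")
  case True
  then show "n < p ^ m \<Longrightarrow> digit p n i = 0" by (cases m) (auto simp: digit_def)
next
  case False
  assume "n < p ^ m" "m \<le> i"
  then have "n < p ^ i" using False power_increasing[of m i p] by simp
  then show "digit p n i = 0" by (simp add: digit_def)
qed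

text \<open>The nonzero leading letter stands at position i + |w| - 1, and from position m on all
  digits are 0.\<close>

lemma occurrences_bounded:
  assumes "n < p ^ m" "w \<noteq> []" "hd w \<noteq> 0" "digit_word p n i (length w) = w"
  shows "i + length w \<le> m"
proof (rule ccontr)
  assume "\<not> i + length w \<le> m"
  then have "m \<le> i + (length w - 1)" by simp
  then show False
    using occurrence_top_digit[OF assms(4,2)] digit_eq_0[OF assms(1)] assms(3) by metis
qed

lemma T_word_digit:
  assumes "prime p" "word_val p v < p"
  shows "T_word p v = 1"
proof -
  let ?d = "word_val p v"
  have "T_poly p ?d = of_nat (?d + 1)"
    using T_poly_rec[OF assms, of 0] by simp
  moreover have "theta p 0 0 = 1"
    using coeff_T_poly[of p 0 0] by simp
  then have "theta p 0 ?d = ?d + 1"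
    using theta_0_rec[OF assms, of 0] by simp
  ultimately have "T_bar p ?d = 1"
    by (simp add: T_bar_def of_nat_poly one_pCons del: of_nat_Suc)
  then show ?thesis by (simp add: T_word_def)
qed

text \<open>The value 1 off the admissible words lets the telescoping product run over all factors
  of the padded expansion, including those with leading zeros.\<close>

definition r_ext :: "nat \<Rightarrow> nat list \<Rightarrow> rat fps" where
  "r_ext p w = (if w \<in> adm_words p then r_word p w else 1)"

text \<open>For an inadmissible word the error term of \<open>T_word_second_difference\<close>
  vanishes, so the defining relation of r_w holds with the value 1.\<close>

lemma r_ext_mult:
  assumes p: "prime p" and digits: "d < p" "e < p" "set u \<subseteq> {..<p}"
  shows "r_ext p (d # u @ [e]) * (T_word p (d # u) * T_word p (u @ [e])) =
    T_word p (d # u @ [e]) * T_word p u"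
proof (cases "d # u @ [e] \<in> adm_words p")
  case True
  let ?D = "T_word p (d # u) * T_word p (u @ [e])"
  have ext: "d # u @ [e] \<in> ext_words p" using True by (auto simp: adm_words_def ext_words_def)
  have D: "fps_nth ?D 0 \<noteq> 0" by (simp add: T_word_nth_0)
  have "r_ext p (d # u @ [e]) = T_word p (d # u @ [e]) * T_word p u * inverse ?D"
    using True fps_divide_unit[OF D] by (simp add: r_ext_def r_word_eq[OF p refl ext])
  then show ?thesis using inverse_mult_eq_1[OF D] by (simp add: mult.assoc)
next
  case False
  have "set u \<subseteq> {0..p - 1}" "d \<le> p - 1" "e \<le> p - 1" using digits by auto
  then have "d = 0 \<or> e = p - 1" using False by (auto simp: adm_words_def)
  then show ?thesis
    using T_word_second_difference[OF p digits(1,3,2)] False by (auto simp: r_ext_def)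
qed

abbreviation T_fps :: "nat \<Rightarrow> nat \<Rightarrow> rat fps" where
  "T_fps p n \<equiv> fps_of_poly (T_bar p n)"

lemma T_word_digit_word: "T_word p (digit_word p n i m) = T_fps p ((n div p ^ i) mod p ^ m)"
  by (simp add: T_word_def word_val_digit_word)

lemma T_fps_nonzero: "T_fps p n \<noteq> 0"
proof
  assume "T_fps p n = 0"
  then have "fps_nth (T_fps p n) 0 = 0" by simp
  then show False using coeff_T_bar_0[of p n] by simp
qed

lemma T_fps_0 [simp]: "prime p \<Longrightarrow> T_fps p 0 = 1"
  using T_word_digit[of p "[]"] by (simp add: T_word_def prime_gt_0_nat)

text \<open>For a fixed right end i the product telescopes in the length: one more digit on the left
  multiplies the quotient of the T for right ends i and i + 1 by the matching
  \<open>r_ext\<close>.\<close>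

lemma prod_r_ext_at:
  assumes p: "prime p"
  shows "(\<Prod>m<M. r_ext p (digit_word p n i (m + 2))) * T_fps p ((n div p ^ Suc i) mod p ^ M) =
    T_fps p ((n div p ^ i) mod p ^ Suc M)"
proof (induction M)
  case 0
  \<comment> \<open>The product is empty here, and for a single digit the normalised T is 1.\<close>
  have "word_val p (digit_word p n i 1) < p"
    using prime_gt_0_nat[OF p] by (simp add: word_val_digit_word)
  then show ?case
    using T_word_digit[OF p, of "digit_word p n i 1"] p
    by (simp add: T_word_digit_word)
next
  case (Suc M)
  have p0: "p > 0" using p by (rule prime_gt_0_nat)
  let ?d = "digit p n (i + Suc M)" and ?u = "digit_word p n (Suc i) M" and ?e = "digit p n i"
  let ?T = "\<lambda>i m. T_fps p ((n div p ^ i) mod p ^ m)"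
  let ?P = "\<Prod>m<M. r_ext p (digit_word p n i (m + 2))"
  have w: "?d # digit_word p n i (Suc M) = digit_word p n i (M + 2)"
    "?d # ?u = digit_word p n (Suc i) (Suc M)" "?u @ [?e] = digit_word p n i (Suc M)"
    by (simp_all add: digit_word_Suc[of _ _ i "Suc M"] digit_word_Suc[of _ _ "Suc i" M] digit_word_Suc'[of _ _ i M])
  have "r_ext p (digit_word p n i (M + 2)) * (?T (Suc i) (Suc M) * ?T i (Suc M)) =
      ?T i (M + 2) * ?T (Suc i) M"
    using r_ext_mult[OF p digit_less digit_less set_digit_word, OF p0 p0 p0, of n "i + Suc M" n "Suc i" M n i]
    unfolding w T_word_digit_word .
  from arg_cong[OF this, of "\<lambda>z. ?P * z"]
  have "?P * r_ext p (digit_word p n i (M + 2)) * ?T (Suc i) (Suc M) * ?T i (Suc M) =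
      (?P * ?T (Suc i) M) * ?T i (M + 2)"
    by (simp only: mult_ac)
  also have "\<dots> = ?T i (M + 2) * ?T i (Suc M)"
    unfolding Suc.IH by (rule mult.commute)
  \<comment> \<open>The common factor \<open>?T i (Suc M)\<close> is nonzero and cancels.\<close>
  finally show ?case using T_fps_nonzero by (simp add: mult_ac)
qed

text \<open>As n < p^M, the reductions modulo powers of p have no effect, and the products for the
  single right ends telescope from n to n div p^M = 0.\<close>

lemma prod_r_ext:
  assumes p: "prime p" and n: "n < p ^ M"
  shows "(\<Prod>i<M. \<Prod>m<M. r_ext p (digit_word p n i (m + 2))) = T_fps p n"
proof -
  have le: "n div p ^ i < p ^ M" for i
    using n by (meson div_le_dividend order_le_less_trans)
  have lt: "n div p ^ i < p ^ Suc M" for i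
    using le[of i] prime_gt_0_nat[OF p] by (simp add: less_le_trans)
  have step: "(\<Prod>m<M. r_ext p (digit_word p n i (m + 2))) * T_fps p (n div p ^ Suc i) = T_fps p (n div p ^ i)" for i
    using prod_r_ext_at[OF p, of n i M] le[of "Suc i"] lt[of i] by (simp only: mod_less)
  have "(\<Prod>i<K. \<Prod>m<M. r_ext p (digit_word p n i (m + 2))) * T_fps p (n div p ^ K) = T_fps p n" for K
  proof (induction K)
    case (Suc K)
    then show ?case using step[of K] by (simp add: mult.assoc)
  qed simp
  from this[of M] show ?thesis using n p by simp
qed

lemma finite_adm_words_length: "finite {w \<in> adm_words p. length w \<le> M}"
  by (rule finite_subset[OF _ finite_lists_length_le[of "{0..p - 1}" M]]) (auto simp: adm_words_def)

text \<open>The double product is regrouped by words: an occurrence of an admissible word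
  corresponds to a right end together with a length. The longest factors in the double product have
  length M + 1.\<close>

lemma prod_r_word_occ:
  assumes p: "prime p" and n: "n < p ^ M"
  shows "(\<Prod>w\<in>{w \<in> adm_words p. length w \<le> Suc M}. r_word p w ^ occ p w n) = T_fps p n"
proof -
  let ?V = "{w \<in> adm_words p. length w \<le> Suc M}"
  define I where "I w = {i. digit_word p n i (length w) = w}" for w
  have I: "i + length w \<le> M" if "i \<in> I w" "w \<in> adm_words p" for i w
    using that by (intro occurrences_bounded[OF n]) (auto simp: I_def adm_words_def)
  have finI: "finite (I w)" if "w \<in> adm_words p" for w
  proof (rule finite_subset)
    show "I w \<subseteq> {..M}" using I[OF _ that] add_leD1 by blast
  qed simp
  have "(\<Prod>w\<in>?V. r_word p w ^ occ p w n) = (\<Prod>w\<in>?V. \<Prod>i\<in>I w. r_word p w)"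
    by (simp add: occ_eq_card_digit_word I_def)
  also have "\<dots> = (\<Prod>(w, i)\<in>Sigma ?V I. r_word p w)"
    using finite_adm_words_length finI by (intro prod.Sigma) auto
  also have "\<dots> = (\<Prod>(i, m)\<in>{(i, m) \<in> {..<M} \<times> {..<M}. digit_word p n i (m + 2) \<in> adm_words p}.
      r_word p (digit_word p n i (m + 2)))"
  proof (rule prod.reindex_bij_witness[of _ "\<lambda>(i, m). (digit_word p n i (m + 2), i)"
        "\<lambda>(w, i). (i, length w - 2)"])
    fix x assume x: "x \<in> Sigma ?V I"
    obtain w i where wi: "x = (w, i)" by force
    with x have w: "w \<in> adm_words p" "i \<in> I w" by auto
    then have "length w \<ge> 2" "i + length w \<le> M" "digit_word p n i (length w) = w"
      using I by (auto simp: adm_words_def I_def)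
    moreover from this have "length w - 2 + 2 = length w" by simp
    ultimately show
      "(case case x of (w, i) \<Rightarrow> (i, length w - 2) of (i, m) \<Rightarrow> (digit_word p n i (m + 2), i)) = x"
      "(case x of (w, i) \<Rightarrow> (i, length w - 2)) \<in>
        {(i, m) \<in> {..<M} \<times> {..<M}. digit_word p n i (m + 2) \<in> adm_words p}"
      "(case case x of (w, i) \<Rightarrow> (i, length w - 2) of (i, m) \<Rightarrow> r_word p (digit_word p n i (m + 2))) =
        (case x of (w, i) \<Rightarrow> r_word p w)"
      using w(1) unfolding wi by (auto simp del: add_2_eq_Suc')
  qed (auto simp: I_def)
  \<comment> \<open>Pairs whose factor is not admissible contribute 1.\<close>
  also have "\<dots> = (\<Prod>(i, m)\<in>{..<M} \<times> {..<M}. r_ext p (digit_word p n i (m + 2)))"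
    by (intro prod.mono_neutral_cong_left) (auto simp: r_ext_def split: if_splits)
  also have "\<dots> = (\<Prod>i<M. \<Prod>m<M. r_ext p (digit_word p n i (m + 2)))"
    by (simp add: prod.cartesian_product)
  finally show ?thesis unfolding prod_r_ext[OF p n] .
qed

section \<open>The polynomials with logarithmic coefficients\<close>

lemma mpoly_eval_eq_sum:
  assumes "finite K" "Poly_Mapping.keys P \<subseteq> K" "finite V" "\<And>m. m \<in> K \<Longrightarrow> Poly_Mapping.keys m \<subseteq> V"
  shows "mpoly_eval x P =
    (\<Sum>m\<in>K. Poly_Mapping.lookup P m * (\<Prod>v\<in>V. x v ^ Poly_Mapping.lookup m v))"
proof -
  have "(\<Prod>v\<in>Poly_Mapping.keys m. x v ^ Poly_Mapping.lookup m v) = (\<Prod>v\<in>V. x v ^ Poly_Mapping.lookup m v)"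
    if "m \<in> K" for m
    using assms(3) assms(4)[OF that] by (intro prod.mono_neutral_left) (auto simp: in_keys_iff)
  then have "mpoly_eval x P =
      (\<Sum>m\<in>Poly_Mapping.keys P. Poly_Mapping.lookup P m * (\<Prod>v\<in>V. x v ^ Poly_Mapping.lookup m v))"
    using assms(2) unfolding mpoly_eval_def by (intro sum.cong) auto
  also have "\<dots> = (\<Sum>m\<in>K. Poly_Mapping.lookup P m * (\<Prod>v\<in>V. x v ^ Poly_Mapping.lookup m v))"
    using assms(1,2) by (intro sum.mono_neutral_left) (auto simp: in_keys_iff)
  finally show ?thesis .
qed

text \<open>Each exponent is bounded separately, not the total degree, so that sums over these
  monomials factor over the variables.\<close>

definition bounded_monomials :: "'v set \<Rightarrow> nat \<Rightarrow> ('v \<Rightarrow>\<^sub>0 nat) set" where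
  "bounded_monomials V j = {m. Poly_Mapping.keys m \<subseteq> V \<and> (\<forall>v. Poly_Mapping.lookup m v \<le> j)}"

lemma finite_bounded_monomials:
  assumes "finite V"
  shows "finite (bounded_monomials V j)"
proof (rule finite_imageD)
  have "Poly_Mapping.lookup ` bounded_monomials V j \<subseteq>
      {f. \<forall>v. (v \<in> V \<longrightarrow> f v \<in> {..j}) \<and> (v \<notin> V \<longrightarrow> f v = 0)}"
    by (auto simp: bounded_monomials_def in_keys_iff)
  then show "finite (Poly_Mapping.lookup ` bounded_monomials V j)"
    by (rule finite_subset) (intro finite_set_of_finite_funs assms finite_atMost)
  show "inj_on Poly_Mapping.lookup (bounded_monomials V j)"
    by (auto intro!: inj_onI poly_mapping_eqI)
qed

lemma sum_bounded_monomials_eq_prod: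
  fixes f :: "'v \<Rightarrow> nat \<Rightarrow> 'a::comm_semiring_1"
  assumes V: "finite V"
  shows "(\<Sum>m\<in>bounded_monomials V j. \<Prod>v\<in>V. f v (Poly_Mapping.lookup m v)) = (\<Prod>v\<in>V. \<Sum>k\<le>j. f v k)"
proof -
  define mk where "mk g = Abs_poly_mapping (\<lambda>v. if v \<in> V then g v else 0)" for g :: "'v \<Rightarrow> nat"
  have lookup_mk: "Poly_Mapping.lookup (mk g) v = (if v \<in> V then g v else 0)" for g v
    unfolding mk_def using V by (subst lookup_Abs_poly_mapping) (auto elim!: rev_finite_subset)
  have "(\<Sum>m\<in>bounded_monomials V j. \<Prod>v\<in>V. f v (Poly_Mapping.lookup m v)) =
      (\<Sum>g\<in>PiE V (\<lambda>_. {..j}). \<Prod>v\<in>V. f v (g v))"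
  proof (rule sum.reindex_bij_witness[of _ mk "\<lambda>m. restrict (Poly_Mapping.lookup m) V"])
    show "mk (restrict (Poly_Mapping.lookup m) V) = m" if "m \<in> bounded_monomials V j" for m
      using that by (intro poly_mapping_eqI) (auto simp: lookup_mk bounded_monomials_def in_keys_iff)
    show "restrict (Poly_Mapping.lookup (mk g)) V = g" if "g \<in> PiE V (\<lambda>_. {..j})" for g
      using that by (intro ext) (auto simp: lookup_mk restrict_def PiE_def extensional_def)
    show "mk g \<in> bounded_monomials V j" if "g \<in> PiE V (\<lambda>_. {..j})" for g
      using that by (auto simp: bounded_monomials_def lookup_mk in_keys_iff split: if_splits)
  qed (auto simp: bounded_monomials_def)
  then show ?thesis using V by (simp add: prod_sum_PiE)
qed

text \<open>Coefficients up to x^j of a product involve only such coefficients of its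
  factors.\<close>

lemma fps_prod_nth_cong:
  fixes f g :: "'v \<Rightarrow> 'a::comm_ring_1 fps"
  assumes "\<And>v i. v \<in> V \<Longrightarrow> i \<le> j \<Longrightarrow> fps_nth (f v) i = fps_nth (g v) i" "i \<le> j"
  shows "fps_nth (prod f V) i = fps_nth (prod g V) i"
  using assms
proof (induction V arbitrary: i rule: infinite_finite_induct)
  case (insert v V)
  then show ?case by (auto simp: fps_mult_nth intro!: sum.cong arg_cong2[of _ _ _ _ "(*)"])
qed auto

lemma fps_const_prod: "fps_const (prod f A) = (\<Prod>x\<in>A. fps_const (f x :: 'a::comm_ring_1))"
  by (induction A rule: infinite_finite_induct) (simp_all flip: fps_const_mult)

text \<open>The series whose coefficient of x^j is to be the coefficient of m in P_j.\<close>

definition log_monomial :: "nat \<Rightarrow> (nat list \<Rightarrow>\<^sub>0 nat) \<Rightarrow> rat fps" where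
  "log_monomial p m = (\<Prod>v\<in>Poly_Mapping.keys m. fps_const (1 / fact (Poly_Mapping.lookup m v)) *
     fps_log (r_word p v) ^ Poly_Mapping.lookup m v)"

text \<open>If v has exponent k in m, the series is divisible by x to the power (|v| - 1) k, hence
  (|v| - 1) k \<le> j; both factors are positive.\<close>

lemma log_monomial_nth_nonzero:
  assumes p: "prime p" and m: "Poly_Mapping.keys m \<subseteq> adm_words p"
    and nz: "fps_nth (log_monomial p m) j \<noteq> 0" and v: "v \<in> Poly_Mapping.keys m"
  shows "length v \<le> Suc j" "Poly_Mapping.lookup m v \<le> j"
proof -
  let ?k = "Poly_Mapping.lookup m v"
  have "fps_log (r_word p v) ^ ?k dvd fps_const (1 / fact ?k) * fps_log (r_word p v) ^ ?k"
    by simp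
  also have "\<dots> dvd log_monomial p m"
    unfolding log_monomial_def using v by (intro dvd_prodI) auto
  finally have "(fps_X ^ (length v - 1)) ^ ?k dvd log_monomial p m"
    using fps_X_power_dvd_log_r_word[OF p, of v] m v by (meson dvd_power_same dvd_trans subsetD)
  then have le: "(length v - 1) * ?k \<le> j"
    using nz fps_X_power_dvd_nth[of "(length v - 1) * ?k" "log_monomial p m" j]
    unfolding power_mult[symmetric] by (meson not_le)
  have "v \<in> adm_words p" using m v by blast
  then have pos: "length v - 1 > 0" "?k > 0"
    using v by (auto simp: adm_words_def in_keys_iff)
  have "length v - 1 \<le> (length v - 1) * ?k" "?k \<le> (length v - 1) * ?k"
    using pos by auto
  then show "length v \<le> Suc j" "?k \<le> j" using le by linarith+
qed

definition log_poly :: "nat \<Rightarrow> nat \<Rightarrow> (nat list, rat) mpoly" where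
  "log_poly p j = Abs_poly_mapping (\<lambda>m. if Poly_Mapping.keys m \<subseteq> adm_words p then fps_nth (log_monomial p m) j else 0)"

text \<open>This gives the finite support that \<open>Abs_poly_mapping\<close> requires. The free
  bound M allows the set of words to be enlarged when the polynomial is evaluated.\<close>

lemma log_poly_support:
  assumes p: "prime p" and M: "j \<le> M"
  shows "{m. (if Poly_Mapping.keys m \<subseteq> adm_words p then fps_nth (log_monomial p m) j else 0) \<noteq> 0}
    \<subseteq> bounded_monomials {w \<in> adm_words p. length w \<le> Suc M} j"
proof
  fix m assume "m \<in> {m. (if Poly_Mapping.keys m \<subseteq> adm_words p then fps_nth (log_monomial p m) j else 0) \<noteq> 0}"
  then have m: "Poly_Mapping.keys m \<subseteq> adm_words p" "fps_nth (log_monomial p m) j \<noteq> 0"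
    by (auto split: if_splits)
  have "Poly_Mapping.lookup m v \<le> j" for v
    using log_monomial_nth_nonzero(2)[OF p m, of v] by (cases "v \<in> Poly_Mapping.keys m") (auto simp: in_keys_iff)
  moreover have "length v \<le> Suc M" if "v \<in> Poly_Mapping.keys m" for v
    using log_monomial_nth_nonzero(1)[OF p m that] M by simp
  ultimately show "m \<in> bounded_monomials {w \<in> adm_words p. length w \<le> Suc M} j"
    using m(1) by (auto simp: bounded_monomials_def)
qed

lemma lookup_log_poly:
  assumes "prime p"
  shows "Poly_Mapping.lookup (log_poly p j) m =
    (if Poly_Mapping.keys m \<subseteq> adm_words p then fps_nth (log_monomial p m) j else 0)"
proof -
  have "finite {m. (if Poly_Mapping.keys m \<subseteq> adm_words p then fps_nth (log_monomial p m) j else 0) \<noteq> 0}"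
    by (rule finite_subset[OF log_poly_support[OF assms order_refl] finite_bounded_monomials])
      (rule finite_adm_words_length)
  then show ?thesis unfolding log_poly_def by (subst lookup_Abs_poly_mapping) auto
qed

lemma mpoly_vars_log_poly: "prime p \<Longrightarrow> mpoly_vars (log_poly p j) \<subseteq> adm_words p"
proof
  fix v assume "prime p" and "v \<in> mpoly_vars (log_poly p j)"
  then obtain m where m: "m \<in> Poly_Mapping.keys (log_poly p j)" "v \<in> Poly_Mapping.keys m"
    unfolding mpoly_vars_def by blast
  then have "Poly_Mapping.lookup (log_poly p j) m \<noteq> 0" by (simp add: in_keys_iff)
  then have "Poly_Mapping.keys m \<subseteq> adm_words p"
    using lookup_log_poly[OF \<open>prime p\<close>] by (metis (full_types))
  then show "v \<in> adm_words p" using m(2) by blast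
qed

lemma less_power_self:
  assumes "1 < (p::nat)"
  shows "n < p ^ n"
  by (rule less_le_trans[OF less_exp power_mono]) (use assms in auto)

text \<open>At the occurrence numbers the sum over monomials becomes a product of truncated
  exponential series, which agree with the powers of r_w up to x^j. The product of these powers is
  the normalised T_n.\<close>

lemma mpoly_eval_log_poly:
  assumes p: "prime p"
  shows "mpoly_eval (\<lambda>w. of_nat (occ p w n)) (log_poly p j) = of_nat (theta p j n) / of_nat (theta p 0 n)"
proof -
  \<comment> \<open>The bound must be at least j + 1 to cover the support of
    \<open>log_poly\<close>, and n < p^(j + n) is needed for the product formula.\<close>
  define V where "V = {w \<in> adm_words p. length w \<le> Suc (j + n)}"
  let ?K = "bounded_monomials V j"
  let ?a = "\<lambda>w. occ p w n"
  let ?f = "\<lambda>v k. fps_const (1 / fact k) * fps_log (r_word p v) ^ k * of_nat (?a v) ^ k"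
  have V: "finite V" unfolding V_def by (rule finite_adm_words_length)
  have summand: "Poly_Mapping.lookup (log_poly p j) m * (\<Prod>v\<in>V. of_nat (?a v) ^ Poly_Mapping.lookup m v) =
      fps_nth (\<Prod>v\<in>V. ?f v (Poly_Mapping.lookup m v)) j" if m: "m \<in> ?K" for m
  proof -
    have keys: "Poly_Mapping.keys m \<subseteq> V" using m by (simp add: bounded_monomials_def)
    then have "Poly_Mapping.lookup (log_poly p j) m = fps_nth (log_monomial p m) j"
      using lookup_log_poly[OF p, of j m] by (auto simp: V_def)
    also have "log_monomial p m = (\<Prod>v\<in>V. fps_const (1 / fact (Poly_Mapping.lookup m v)) *
        fps_log (r_word p v) ^ Poly_Mapping.lookup m v)"
      unfolding log_monomial_def using keys V
      by (intro prod.mono_neutral_left) (auto simp: in_keys_iff)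
    finally have *: "Poly_Mapping.lookup (log_poly p j) m = fps_nth (\<Prod>v\<in>V.
        fps_const (1 / fact (Poly_Mapping.lookup m v)) * fps_log (r_word p v) ^ Poly_Mapping.lookup m v) j" .
    have "(\<Prod>v\<in>V. ?f v (Poly_Mapping.lookup m v)) =
        (\<Prod>v\<in>V. fps_const (1 / fact (Poly_Mapping.lookup m v)) * fps_log (r_word p v) ^ Poly_Mapping.lookup m v) *
        fps_const (\<Prod>v\<in>V. of_nat (?a v) ^ Poly_Mapping.lookup m v)"
      by (simp add: prod.distrib fps_const_prod fps_const_power flip: fps_of_nat)
    then show ?thesis by (simp add: *)
  qed
  have "p ^ n \<le> p ^ (j + n)" using prime_gt_0_nat[OF p] by (intro power_increasing) auto
  then have np: "n < p ^ (j + n)"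
    using less_power_self[OF prime_gt_1_nat[OF p], of n] by (rule order_less_le_trans[rotated])
  have "{m. (if Poly_Mapping.keys m \<subseteq> adm_words p then fps_nth (log_monomial p m) j else 0) \<noteq> 0} \<subseteq> ?K"
    unfolding V_def by (rule log_poly_support[OF p]) simp
  then have "Poly_Mapping.keys (log_poly p j) \<subseteq> ?K"
    by (auto simp: in_keys_iff lookup_log_poly[OF p] subset_iff)
  then have "mpoly_eval (\<lambda>w. of_nat (?a w)) (log_poly p j) =
      (\<Sum>m\<in>?K. Poly_Mapping.lookup (log_poly p j) m * (\<Prod>v\<in>V. of_nat (?a v) ^ Poly_Mapping.lookup m v))"
    using V finite_bounded_monomials[OF V] by (intro mpoly_eval_eq_sum) (auto simp: bounded_monomials_def)
  also have "\<dots> = (\<Sum>m\<in>?K. fps_nth (\<Prod>v\<in>V. ?f v (Poly_Mapping.lookup m v)) j)"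
    using summand by (rule sum.cong[OF refl])
  also have "\<dots> = fps_nth (\<Sum>m\<in>?K. \<Prod>v\<in>V. ?f v (Poly_Mapping.lookup m v)) j"
    by (simp add: fps_sum_nth)
  also have "\<dots> = fps_nth (\<Prod>v\<in>V. \<Sum>k\<le>j. ?f v k) j"
    by (simp only: sum_bounded_monomials_eq_prod[OF V, of ?f j])
  also have "\<dots> = fps_nth (\<Prod>v\<in>V. r_word p v ^ ?a v) j"
    by (intro fps_prod_nth_cong[of _ j]) (simp_all only: fps_power_nth_eq_exp_log[OF r_word_nth_0] order_refl)
  also have "\<dots> = fps_nth (T_fps p n) j"
    unfolding V_def prod_r_word_occ[OF p np] ..
  also have "\<dots> = of_nat (theta p j n) / of_nat (theta p 0 n)"
    by (simp add: T_bar_def coeff_T_poly)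
  finally show ?thesis .
qed

section \<open>Uniqueness\<close>

lemma poly_eq_0_of_nat:
  fixes q :: "rat poly"
  assumes "\<And>t::nat. poly q (of_nat t) = 0"
  shows "q = 0"
proof (rule ccontr)
  assume "q \<noteq> 0"
  then have "finite {x. poly q x = 0}" by (rule poly_roots_finite)
  moreover have "range of_nat \<subseteq> {x. poly q x = 0}" using assms by auto
  ultimately have "finite (range (of_nat :: nat \<Rightarrow> rat))" by (rule rev_finite_subset)
  then show False by (simp add: finite_image_iff inj_on_def)
qed

text \<open>Induction on the variables: with the others fixed, the sum is a polynomial in v with all
  naturals as roots, so the part with any given exponent of v vanishes. Monomials sharing that
  exponent are still told apart by the other variables.\<close>

lemma coefficients_eq_0_of_vanishing:
  fixes c :: "('v \<Rightarrow> nat) \<Rightarrow> rat"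
  assumes "finite V" "finite K"
    and "\<And>m m'. m \<in> K \<Longrightarrow> m' \<in> K \<Longrightarrow> (\<forall>v\<in>V. m v = m' v) \<Longrightarrow> m = m'"
    and "\<And>a :: 'v \<Rightarrow> nat. (\<Sum>m\<in>K. c m * (\<Prod>v\<in>V. of_nat (a v) ^ m v)) = 0"
    and "m \<in> K"
  shows "c m = 0"
  using assms
proof (induction V arbitrary: K m rule: finite_induct)
  case (empty K m)
  then have "K = {m}" by blast
  then show ?case using empty.prems(3) by simp
next
  case (insert v V K m0)
  let ?K = "{m \<in> K. m v = m0 v}"
  show ?case
  proof (rule insert.IH)
    show "finite ?K" using insert.prems by simp
    show "m = m'" if "m \<in> ?K" "m' \<in> ?K" "\<forall>v\<in>V. m v = m' v" for m m'
      using that insert.prems(2)[of m m'] by auto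
    show "m0 \<in> ?K" using insert.prems by simp
    fix a :: "'v \<Rightarrow> nat"
    define q where "q = (\<Sum>m\<in>K. monom (c m * (\<Prod>u\<in>V. of_nat (a u) ^ m u)) (m v))"
    have "poly q (of_nat t) = 0" for t
    proof -
      have "(\<Prod>u\<in>V. of_nat ((a(v := t)) u) ^ m u) = (\<Prod>u\<in>V. of_nat (a u) ^ m u :: rat)" for m
        using insert.hyps by (intro prod.cong) auto
      then have "poly q (of_nat t) = (\<Sum>m\<in>K. c m * (\<Prod>u\<in>insert v V. of_nat ((a(v := t)) u) ^ m u))"
        using insert.hyps by (simp add: q_def poly_sum poly_monom mult_ac)
      then show ?thesis using insert.prems(3) by simp
    qed
    then have "q = 0" by (rule poly_eq_0_of_nat)
    then have "coeff q (m0 v) = 0" by simp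
    then have "(\<Sum>m\<in>K. if m v = m0 v then c m * (\<Prod>u\<in>V. of_nat (a u) ^ m u) else 0) = 0"
      by (simp add: q_def coeff_sum)
    then show "(\<Sum>m\<in>?K. c m * (\<Prod>u\<in>V. of_nat (a u) ^ m u)) = 0"
      using insert.prems by (simp add: sum.inter_filter)
  qed
qed

section \<open>Occurrences in concatenated expansions\<close>

lemma digit_mult_power_add:
  assumes "p > 0" "b < p ^ m"
  shows "digit p (n * p ^ m + b) i = (if i < m then digit p b i else digit p n (i - m))"
proof (cases "i < m")
  case True
  then obtain k where k: "m = Suc (i + k)" using less_imp_Suc_add by blast
  have "n * p ^ m + b = b + (n * p ^ k * p) * p ^ i"
    by (simp add: k power_add mult_ac)
  moreover have "(b + (n * p ^ k * p) * p ^ i) div p ^ i = n * p ^ k * p + b div p ^ i"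
    using assms by (intro div_mult_self1) simp
  ultimately have "(n * p ^ m + b) div p ^ i = b div p ^ i + n * p ^ k * p"
    by (simp only: add.commute)
  then show ?thesis using True by (simp add: digit_def)
next
  case False
  then have "p ^ i = p ^ m * p ^ (i - m)" by (simp flip: power_add)
  moreover have "(n * p ^ m + b) div p ^ m = n" using assms by simp
  ultimately show ?thesis using False by (simp add: digit_def div_mult2_eq)
qed

lemma digit_eq_0_of_dvd:
  assumes "p ^ L dvd n" "i < L" "p > 0"
  shows "digit p n i = 0"
proof -
  obtain k where k: "L = Suc (i + k)" using assms(2) less_imp_Suc_add by blast
  obtain q where "n = p ^ L * q" using assms(1) by (elim dvdE)
  then have "n = (p * p ^ k * q) * p ^ i" by (simp add: k power_add mult_ac)
  then show ?thesis using assms(3) by (simp add: digit_def)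
qed

lemma finite_occurrences:
  assumes "1 < p" "v \<noteq> []" "hd v \<noteq> 0"
  shows "finite {i. digit_word p n i (length v) = v}"
proof (rule finite_subset)
  show "{i. digit_word p n i (length v) = v} \<subseteq> {..n}"
    using occurrences_bounded[OF less_power_self[OF assms(1), of n] assms(2,3)] add_leD1 by blast
qed simp

lemma digit_word_cong:
  "(\<And>k. k < m \<Longrightarrow> digit p n (i + k) = digit p n' (i' + k)) \<Longrightarrow> digit_word p n i m = digit_word p n' i' m"
  by (simp add: digit_word_def)

text \<open>An occurrence across the boundary would have its nonzero leading letter among the lowest
  L digits of n, which are 0.\<close>

lemma occ_concat:
  assumes p: "1 < p" and n: "p ^ L dvd n" and b: "b < p ^ m" and v: "v \<noteq> []" "hd v \<noteq> 0" "length v \<le> L"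
  shows "occ p v (n * p ^ m + b) = occ p v n + occ p v b"
proof -
  let ?n = "n * p ^ m + b"
  let ?O = "\<lambda>n. {i. digit_word p n i (length v) = v}"
  have dig: "digit p ?n i = (if i < m then digit p b i else digit p n (i - m))" for i
    using p b by (intro digit_mult_power_add) auto
  have low: "digit_word p ?n i (length v) = digit_word p b i (length v)" if "i + length v \<le> m" for i
    using that by (intro digit_word_cong) (simp add: dig)
  have high: "digit_word p ?n (i + m) (length v) = digit_word p n i (length v)" for i
    by (intro digit_word_cong) (simp add: dig)
  have bnd: "i + length v \<le> m" if "i \<in> ?O b" for i
    using occurrences_bounded[OF b v(1,2)] that by simp
  have "?O ?n = ?O b \<union> (\<lambda>i. i + m) ` ?O n"
  proof (intro equalityI subsetI)
    fix i assume i: "i \<in> ?O ?n"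
    consider "i + length v \<le> m" | "m \<le> i" | "i < m" "m < i + length v" by linarith
    then show "i \<in> ?O b \<union> (\<lambda>i. i + m) ` ?O n"
    proof cases
      case 1
      then show ?thesis using i low by simp
    next
      case 2
      then have "i - m \<in> ?O n" using i high[of "i - m"] by simp
      then show ?thesis using 2 by (intro UnI2 image_eqI[of _ _ "i - m"]) auto
    next
      case 3
      then have "\<not> i + (length v - 1) < m" by linarith
      then have "digit p ?n (i + (length v - 1)) = digit p n (i + (length v - 1) - m)"
        by (simp only: dig if_False)
      also have "\<dots> = 0" using 3 v p by (intro digit_eq_0_of_dvd[OF n]) auto
      finally show ?thesis using occurrence_top_digit[of p ?n i v] i v by simp
    qed
  qed (use low bnd high in auto)
  moreover have "?O b \<inter> (\<lambda>i. i + m) ` ?O n = {}"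
    using bnd v(1) by (fastforce simp: Suc_le_eq)
  moreover have "finite (?O b)" "finite (?O n)" using finite_occurrences[OF p v(1,2)] by auto
  ultimately show ?thesis
    by (simp add: occ_eq_card_digit_word card_Un_disjoint card_image)
qed

lemma occ_add_realizable:
  assumes p: "1 < p" and "p ^ L dvd n" "p ^ L dvd b"
  shows "\<exists>n'. p ^ L dvd n' \<and>
    (\<forall>v. v \<noteq> [] \<longrightarrow> hd v \<noteq> 0 \<longrightarrow> length v \<le> L \<longrightarrow> occ p v n' = occ p v n + occ p v b)"
proof (intro exI conjI allI impI)
  \<comment> \<open>The shift by b places leaves room for b because b < p^b.\<close>
  show "p ^ L dvd n * p ^ b + b" using assms by simp
  show "occ p v (n * p ^ b + b) = occ p v n + occ p v b"
    if "v \<noteq> []" "hd v \<noteq> 0" "length v \<le> L" for v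
    using that assms less_power_self[OF p] by (intro occ_concat) auto
qed

lemma occ_add_multiple_realizable:
  assumes p: "1 < p" and "p ^ L dvd n" "p ^ L dvd b"
  shows "\<exists>n'. p ^ L dvd n' \<and>
    (\<forall>v. v \<noteq> [] \<longrightarrow> hd v \<noteq> 0 \<longrightarrow> length v \<le> L \<longrightarrow> occ p v n' = occ p v n + t * occ p v b)"
proof (induction t)
  case 0
  show ?case using assms by (intro exI[of _ n]) simp
next
  case (Suc t)
  then obtain n1 where n1: "p ^ L dvd n1"
    "\<And>v. v \<noteq> [] \<Longrightarrow> hd v \<noteq> 0 \<Longrightarrow> length v \<le> L \<Longrightarrow> occ p v n1 = occ p v n + t * occ p v b" by blast
  obtain n2 where "p ^ L dvd n2"
    "\<And>v. v \<noteq> [] \<Longrightarrow> hd v \<noteq> 0 \<Longrightarrow> length v \<le> L \<Longrightarrow> occ p v n2 = occ p v n1 + occ p v b"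
    using occ_add_realizable[OF p n1(1) assms(3)] by blast
  with n1 show ?case by (intro exI[of _ n2]) simp
qed

section \<open>Occurrences in padded words\<close>

lemma word_val_less:
  assumes "set v \<subseteq> {..<p}"
  shows "word_val p v < p ^ length v"
  using assms
proof (induction v)
  case (Cons d v)
  then have "word_val p (d # v) < d * p ^ length v + p ^ length v" by (simp add: word_val_Cons)
  also have "\<dots> = Suc d * p ^ length v" by simp
  also have "\<dots> \<le> p * p ^ length v" using Cons.prems by (intro mult_le_mono1) simp
  finally show ?case by simp
qed simp

lemma digit_word_word_val:
  assumes "set v \<subseteq> {..<p}"
  shows "digit_word p (word_val p v) 0 (length v) = v"
  using assms
proof (induction v)
  case (Cons d v)
  then have *: "word_val p v < p ^ length v" "p > 0" by (auto intro: word_val_less)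
  have dig: "digit p (word_val p (d # v)) i =
      (if i < length v then digit p (word_val p v) i else digit p d (i - length v))" for i
    unfolding word_val_Cons using digit_mult_power_add[OF *(2,1)] .
  have "digit_word p (word_val p (d # v)) 0 (length v) = digit_word p (word_val p v) 0 (length v)"
    by (rule digit_word_cong) (simp add: dig)
  moreover have "digit p (word_val p (d # v)) (length v) = d"
    unfolding dig using Cons.prems by (simp add: digit_def)
  ultimately show ?case using Cons by (simp add: digit_word_Suc)
qed (simp add: digit_word_def)

lemma digit_word_append: "digit_word p n 0 (i + m) = digit_word p n i m @ digit_word p n 0 i"
  by (induction m) (simp_all add: digit_word_Suc, simp add: digit_word_def)

text \<open>A new occurrence must use the new top position, which means that v is a prefix. Since v
  does not start with 0, nothing reaches into the padding above.\<close>

lemma occ_Cons: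
  assumes p: "1 < p" and x: "set (d # x) \<subseteq> {..<p}" and v: "v \<noteq> []" "hd v \<noteq> 0"
  shows "occ p v (word_val p (d # x)) = occ p v (word_val p x) + (if prefix v (d # x) then 1 else 0)"
proof -
  let ?n = "word_val p (d # x)" and ?b = "word_val p x"
  let ?O = "\<lambda>n. {i. digit_word p n i (length v) = v}"
  let ?top = "{i. i + length v = Suc (length x) \<and> prefix v (d # x)}"
  have b: "?b < p ^ length x" using x by (intro word_val_less) simp
  have n: "?n < p ^ Suc (length x)" using word_val_less[OF x] by simp
  have low: "digit_word p ?n i (length v) = digit_word p ?b i (length v)" if "i + length v \<le> length x" for i
    using that p b by (intro digit_word_cong) (simp add: word_val_Cons digit_mult_power_add)
  have top: "digit_word p ?n i (length v) = v \<longleftrightarrow> prefix v (d # x)" if "i + length v = Suc (length x)" for i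
  proof -
    have "d # x = digit_word p ?n i (length v) @ digit_word p ?n 0 i"
      using digit_word_word_val[OF x] digit_word_append[of p ?n i "length v"] that by simp
    then have "take (length v) (d # x) = digit_word p ?n i (length v)"
      by (metis append_eq_conv_conj length_digit_word)
    then show ?thesis by (metis take_is_prefix prefix_def append_eq_conv_conj)
  qed
  have bnd: "i + length v \<le> length x" if "i \<in> ?O ?b" for i
    using occurrences_bounded[OF b v] that by simp
  have "?O ?n = ?O ?b \<union> ?top"
  proof (intro equalityI subsetI)
    fix i assume i: "i \<in> ?O ?n"
    then have "i + length v \<le> Suc (length x)" using occurrences_bounded[OF n v] by simp
    then show "i \<in> ?O ?b \<union> ?top" using low[of i] top[of i] i by (cases "i + length v \<le> length x") auto
  qed (use low bnd top in auto)
  moreover have "?O ?b \<inter> ?top = {}" using bnd by fastforce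
  moreover have "finite (?O ?b)" by (rule finite_occurrences[OF p v])
  moreover have "finite ?top" by (rule finite_subset[of _ "{..Suc (length x)}"]) auto
  ultimately have "occ p v ?n = occ p v ?b + card ?top"
    by (simp add: occ_eq_card_digit_word card_Un_disjoint)
  moreover have "card ?top = (if prefix v (d # x) then 1 else 0)"
  proof (cases "prefix v (d # x)")
    case True
    then have "length v \<le> Suc (length x)" using prefix_length_le by fastforce
    then have "?top = {Suc (length x) - length v}" using True by auto
    then show ?thesis using True by simp
  qed simp
  ultimately show ?thesis by simp
qed

text \<open>The zeros make the value divisible by p^L, as concatenation requires; the digits p - 1
  stop admissible words of length at most L from running past the end of x.\<close>

definition padded_val :: "nat \<Rightarrow> nat \<Rightarrow> nat list \<Rightarrow> nat" where
  "padded_val p L x = word_val p (x @ replicate L (p - 1) @ replicate L 0)"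

lemma dvd_padded_val: "p ^ L dvd padded_val p L x"
proof -
  have "word_val p (y @ replicate L 0) = p ^ L * word_val p y" for y
  proof (induction L)
    case (Suc L)
    have "word_val p ((y @ replicate L 0) @ [0]) = p * word_val p (y @ replicate L 0)"
      unfolding word_val_snoc by simp
    then show ?case using Suc by (simp add: replicate_append_same)
  qed simp
  then show ?thesis unfolding padded_val_def by (metis append.assoc dvd_triv_left)
qed

text \<open>
  An admissible word does not end in \<open>p - 1\<close>, so it cannot reach from \<open>x\<close> into the block of
  digits \<open>p - 1\<close>.
\<close>

lemma prefix_padded_iff:
  assumes "last v \<noteq> p - 1" "length v \<le> L"
  shows "prefix v (x @ replicate L (p - 1) @ y) \<longleftrightarrow> prefix v x"
proof
  assume pre: "prefix v (x @ replicate L (p - 1) @ y)"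
  show "prefix v x"
  proof (rule ccontr)
    assume no: "\<not> prefix v x"
    then obtain r where r: "v = x @ r" "r \<noteq> []" "prefix r (replicate L (p - 1) @ y)"
      using pre by (auto simp: prefix_append)
    have "length r \<le> L" using assms(2) r(1) by simp
    have "r = take (length r) (replicate L (p - 1) @ y)"
      using r(3) by (metis append_eq_conv_conj prefix_def)
    also have "\<dots> = replicate (length r) (p - 1)"
      using \<open>length r \<le> L\<close> by simp
    finally have "r = replicate (length r) (p - 1)" .
    then have "last r = p - 1" using r(2) by (metis last_replicate length_0_conv)
    then show False using assms(1) r by simp
  qed
qed (auto simp: prefix_append)

lemma occ_padded_Cons:
  assumes p: "1 < p" and x: "set (d # x) \<subseteq> {..<p}" and v: "v \<in> adm_words p" "length v \<le> L"
  shows "occ p v (padded_val p L (d # x)) = occ p v (padded_val p L x) + (if prefix v (d # x) then 1 else 0)"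
proof -
  let ?y = "replicate L (p - 1) @ replicate L 0"
  have v': "v \<noteq> []" "hd v \<noteq> 0" "last v \<noteq> p - 1" using v by (auto simp: adm_words_def)
  have "set (d # x @ ?y) \<subseteq> {..<p}" using x p by auto
  from occ_Cons[OF p this v'(1,2)] show ?thesis
    using prefix_padded_iff[OF v'(3) v(2), of "d # x"] by (simp add: padded_val_def)
qed

text \<open>Prepending d to u e adds the prefixes of d u e, prepending it to u those of d u. The
  only prefix of the former that is not one of the latter is d u e itself.\<close>

lemma occ_padded_second_difference:
  assumes p: "1 < p" and w: "set (d # u @ [e]) \<subseteq> {..<p}" and v: "v \<in> adm_words p" "length v \<le> L"
  shows "occ p v (padded_val p L (d # u @ [e])) + occ p v (padded_val p L u) =
    occ p v (padded_val p L (d # u)) + occ p v (padded_val p L (u @ [e])) +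
    (if v = d # u @ [e] then 1 else 0)"
proof -
  have "prefix v (d # u @ [e]) \<longleftrightarrow> v = d # u @ [e] \<or> prefix v (d # u)"
    using prefix_snoc[of v "d # u" e] by simp
  moreover have "\<not> prefix (d # u @ [e]) (d # u)" by (auto dest: prefix_length_le)
  ultimately show ?thesis
    using occ_padded_Cons[OF p w v] occ_padded_Cons[OF p _ v, of d u] w by auto
qed

text \<open>The vector a is a difference of occurrence vectors, written additively to stay within
  the natural numbers.\<close>

definition occ_difference :: "nat \<Rightarrow> nat \<Rightarrow> (nat list \<Rightarrow> nat) \<Rightarrow> bool" where
  "occ_difference p L a \<longleftrightarrow> (\<exists>m n. p ^ L dvd m \<and> p ^ L dvd n \<and>
     (\<forall>v\<in>adm_words p. length v \<le> L \<longrightarrow> occ p v m = occ p v n + a v))"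

lemma occ_difference_0: "occ_difference p L (\<lambda>_. 0)"
  unfolding occ_difference_def by (intro exI[of _ 0]) simp

lemma occ_difference_add:
  assumes p: "1 < p" and "occ_difference p L a" "occ_difference p L b"
  shows "occ_difference p L (\<lambda>v. a v + b v)"
proof -
  obtain m n where 1: "p ^ L dvd m" "p ^ L dvd n"
    "\<And>v. v \<in> adm_words p \<Longrightarrow> length v \<le> L \<Longrightarrow> occ p v m = occ p v n + a v"
    using assms(2) unfolding occ_difference_def by blast
  obtain m' n' where 2: "p ^ L dvd m'" "p ^ L dvd n'"
    "\<And>v. v \<in> adm_words p \<Longrightarrow> length v \<le> L \<Longrightarrow> occ p v m' = occ p v n' + b v"
    using assms(3) unfolding occ_difference_def by blast
  have adm: "v \<noteq> [] \<and> hd v \<noteq> 0" if "v \<in> adm_words p" for v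
    using that by (auto simp: adm_words_def)
  obtain M N where M: "p ^ L dvd M"
      "\<And>v. v \<noteq> [] \<Longrightarrow> hd v \<noteq> 0 \<Longrightarrow> length v \<le> L \<Longrightarrow> occ p v M = occ p v m + occ p v m'"
    and N: "p ^ L dvd N"
      "\<And>v. v \<noteq> [] \<Longrightarrow> hd v \<noteq> 0 \<Longrightarrow> length v \<le> L \<Longrightarrow> occ p v N = occ p v n + occ p v n'"
    using occ_add_realizable[OF p 1(1) 2(1)] occ_add_realizable[OF p 1(2) 2(2)] by blast
  show ?thesis
    unfolding occ_difference_def
    by (intro exI[of _ M] exI[of _ N] conjI M(1) N(1) ballI impI) (simp add: M(2) N(2) adm 1(3) 2(3))
qed

text \<open>The second difference of padded words is the unit vector at w; concatenation realises
  the two sums in it by single numbers.\<close>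

lemma occ_difference_unit:
  assumes p: "prime p" and w: "w \<in> adm_words p"
  shows "occ_difference p L (\<lambda>v. if v = w then 1 else 0)"
proof -
  have p1: "1 < p" using p by (rule prime_gt_1_nat)
  obtain d u e where w': "w = d # u @ [e]" "d < p" "e < p" "set u \<subseteq> {..<p}"
    using adm_wordsE[OF w p] by metis
  then have digits: "set (d # u @ [e]) \<subseteq> {..<p}" by auto
  have adm: "v \<noteq> [] \<and> hd v \<noteq> 0" if "v \<in> adm_words p" for v
    using that by (auto simp: adm_words_def)
  obtain m n where m: "p ^ L dvd m" "\<And>v. v \<noteq> [] \<Longrightarrow> hd v \<noteq> 0 \<Longrightarrow> length v \<le> L \<Longrightarrow>
      occ p v m = occ p v (padded_val p L (d # u @ [e])) + occ p v (padded_val p L u)"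
    and n: "p ^ L dvd n" "\<And>v. v \<noteq> [] \<Longrightarrow> hd v \<noteq> 0 \<Longrightarrow> length v \<le> L \<Longrightarrow>
      occ p v n = occ p v (padded_val p L (d # u)) + occ p v (padded_val p L (u @ [e]))"
    using occ_add_realizable[OF p1 dvd_padded_val dvd_padded_val] by metis
  show ?thesis
    unfolding occ_difference_def
    by (intro exI[of _ m] exI[of _ n] conjI m(1) n(1) ballI impI)
      (simp add: m(2) n(2) adm occ_padded_second_difference[OF p1 digits] w'(1))
qed

lemma occ_difference_finite_support:
  assumes p: "prime p" and "finite U" "U \<subseteq> adm_words p"
  shows "occ_difference p L (\<lambda>v. if v \<in> U then a v else 0)"
  using assms(2,3)
proof (induction U rule: finite_induct)
  case empty
  show ?case by (simp add: occ_difference_0)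
next
  case (insert w U)
  have p1: "1 < p" using p by (rule prime_gt_1_nat)
  have "occ_difference p L (\<lambda>v. if v = w then t else 0)" for t
  proof (induction t)
    case 0
    show ?case using occ_difference_0 by simp
  next
    case (Suc t)
    have "w \<in> adm_words p" using insert.prems by simp
    from occ_difference_add[OF p1 Suc occ_difference_unit[OF p this]]
    show ?case by (rule back_subst[of "occ_difference p L"]) (auto simp: fun_eq_iff)
  qed
  then have "occ_difference p L (\<lambda>v. (if v = w then a w else 0) + (if v \<in> U then a v else 0))"
    using insert by (intro occ_difference_add p1) auto
  moreover have "(\<lambda>v. (if v = w then a w else 0) + (if v \<in> U then a v else 0)) =
      (\<lambda>v. if v \<in> insert w U then a v else 0)"
    using insert.hyps by (auto simp: fun_eq_iff)
  ultimately show ?case by simp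
qed

text \<open>
  A polynomial vanishing at the points \<open>A + t B\<close> for all natural \<open>t\<close> also vanishes at \<open>A - B\<close>,
  and every point with natural coordinates is such a difference of occurrence vectors.
\<close>

lemma coefficients_eq_0_of_vanishing_occ:
  fixes c :: "(nat list \<Rightarrow> nat) \<Rightarrow> rat"
  assumes p: "prime p" and V: "finite V" "V \<subseteq> adm_words p" and K: "finite K"
    and inj: "\<And>m m'. m \<in> K \<Longrightarrow> m' \<in> K \<Longrightarrow> (\<forall>v\<in>V. m v = m' v) \<Longrightarrow> m = m'"
    and zero: "\<And>n. (\<Sum>m\<in>K. c m * (\<Prod>v\<in>V. of_nat (occ p v n) ^ m v)) = 0"
    and m: "m \<in> K"
  shows "c m = 0"
proof (rule coefficients_eq_0_of_vanishing[OF V(1) K inj _ m])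
  fix a :: "nat list \<Rightarrow> nat"
  have p1: "1 < p" using p by (rule prime_gt_1_nat)
  obtain L where L: "\<And>v. v \<in> V \<Longrightarrow> length v \<le> L"
    using V(1) by (meson Max_ge finite_imageI imageI)
  have adm: "v \<noteq> [] \<and> hd v \<noteq> 0 \<and> length v \<le> L" if "v \<in> V" for v
    using that V L by (auto simp: adm_words_def)
  obtain A B where AB: "p ^ L dvd A" "p ^ L dvd B" "\<And>v. v \<in> V \<Longrightarrow> occ p v A = occ p v B + a v"
  proof -
    obtain A B where "p ^ L dvd A" "p ^ L dvd B" and
      diff: "\<forall>v\<in>adm_words p. length v \<le> L \<longrightarrow> occ p v A = occ p v B + (if v \<in> V then a v else 0)"
      using occ_difference_finite_support[OF p V, of L a] unfolding occ_difference_def by blast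
    moreover have "occ p v A = occ p v B + a v" if "v \<in> V" for v
      using diff L[OF that] V(2) that by auto
    ultimately show ?thesis using that by blast
  qed
  define q where "q = (\<Sum>m\<in>K. smult (c m) (\<Prod>v\<in>V. [:of_nat (occ p v A), of_nat (occ p v B):] ^ m v))"
  have poly_q: "poly q t = (\<Sum>m\<in>K. c m * (\<Prod>v\<in>V. (of_nat (occ p v A) + t * of_nat (occ p v B)) ^ m v))" for t
    by (simp add: q_def poly_sum poly_prod)
  have "poly q (of_nat t) = 0" for t
  proof -
    obtain n where n: "\<And>v. v \<noteq> [] \<Longrightarrow> hd v \<noteq> 0 \<Longrightarrow> length v \<le> L \<Longrightarrow> occ p v n = occ p v A + t * occ p v B"
      using occ_add_multiple_realizable[OF p1 AB(1,2), of t] by blast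
    have "poly q (of_nat t) = (\<Sum>m\<in>K. c m * (\<Prod>v\<in>V. of_nat (occ p v n) ^ m v))"
      unfolding poly_q by (intro sum.cong prod.cong arg_cong2[of _ _ _ _ "(*)"] refl) (simp add: n adm)
    then show ?thesis using zero by simp
  qed
  then have "q = 0" by (rule poly_eq_0_of_nat)
  then have "0 = poly q (-1)" by simp
  also have "poly q (-1) = (\<Sum>m\<in>K. c m * (\<Prod>v\<in>V. of_nat (a v) ^ m v))"
    unfolding poly_q by (intro sum.cong prod.cong arg_cong2[of _ _ _ _ "(*)"] refl) (simp add: AB(3))
  finally show "(\<Sum>m\<in>K. c m * (\<Prod>v\<in>V. of_nat (a v) ^ m v)) = 0" ..
qed

section \<open>Identification of \<open>P_poly\<close> and the coefficient formula\<close>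

lemma P_poly_eq_log_poly:
  assumes p: "prime p"
  shows "P_poly p j = log_poly p j"
  unfolding P_poly_def
proof (rule the_equality)
  let ?ev = "\<lambda>n P. mpoly_eval (\<lambda>w. of_nat (occ p w n)) P"
  let ?\<theta> = "\<lambda>n. of_nat (theta p j n) / of_nat (theta p 0 n) :: rat"
  show "mpoly_vars (log_poly p j) \<subseteq> adm_words p \<and> (\<forall>n. ?\<theta> n = ?ev n (log_poly p j))"
    using mpoly_vars_log_poly[OF p] mpoly_eval_log_poly[OF p] by simp
  fix P assume P: "mpoly_vars P \<subseteq> adm_words p \<and> (\<forall>n. ?\<theta> n = ?ev n P)"
  let ?Q = "log_poly p j"
  define K where "K = Poly_Mapping.keys P \<union> Poly_Mapping.keys ?Q"
  define V where "V = mpoly_vars P \<union> mpoly_vars ?Q"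
  \<comment> \<open>The vanishing criterion takes monomials as plain functions, so the coefficients
    of the difference are transported along \<open>Abs_poly_mapping\<close>.\<close>
  define c where "c f = Poly_Mapping.lookup P (Abs_poly_mapping f) - Poly_Mapping.lookup ?Q (Abs_poly_mapping f)" for f
  have fin: "finite K" "finite V" by (auto simp: K_def V_def mpoly_vars_def)
  have keys: "Poly_Mapping.keys m \<subseteq> V" if "m \<in> K" for m
    using that by (auto simp: K_def V_def mpoly_vars_def)
  have V: "V \<subseteq> adm_words p" using P mpoly_vars_log_poly[OF p] by (auto simp: V_def)
  have c_lookup: "c (Poly_Mapping.lookup m) = Poly_Mapping.lookup P m - Poly_Mapping.lookup ?Q m" for m
    by (simp add: c_def lookup_inverse)
  have inj: "inj_on Poly_Mapping.lookup K" by (auto intro!: inj_onI poly_mapping_eqI)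
  have zero: "(\<Sum>f\<in>Poly_Mapping.lookup ` K. c f * (\<Prod>v\<in>V. of_nat (occ p v n) ^ f v)) = 0" for n
  proof -
    let ?x = "\<lambda>v. of_nat (occ p v n) :: rat"
    have "mpoly_eval ?x P = (\<Sum>m\<in>K. Poly_Mapping.lookup P m * (\<Prod>v\<in>V. ?x v ^ Poly_Mapping.lookup m v))"
      "mpoly_eval ?x ?Q = (\<Sum>m\<in>K. Poly_Mapping.lookup ?Q m * (\<Prod>v\<in>V. ?x v ^ Poly_Mapping.lookup m v))"
      by (rule mpoly_eval_eq_sum[OF fin(1) _ fin(2) keys]; simp add: K_def)+
    then have "(\<Sum>f\<in>Poly_Mapping.lookup ` K. c f * (\<Prod>v\<in>V. ?x v ^ f v)) = ?ev n P - ?ev n ?Q"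
      by (simp add: sum.reindex[OF inj] c_lookup left_diff_distrib sum_subtractf)
    also have "\<dots> = 0"
      using P mpoly_eval_log_poly[OF p, of n j] by simp
    finally show ?thesis .
  qed
  have "Poly_Mapping.lookup P m = Poly_Mapping.lookup ?Q m" for m
  proof (cases "m \<in> K")
    case True
    have "c (Poly_Mapping.lookup m) = 0"
    proof (rule coefficients_eq_0_of_vanishing_occ[OF p fin(2) V _ _ zero])
      fix f g assume fg: "f \<in> Poly_Mapping.lookup ` K" "g \<in> Poly_Mapping.lookup ` K" "\<forall>v\<in>V. f v = g v"
      \<comment> \<open>Monomials from K vanish outside V, so agreement on V is equality.\<close>
      have "h v = 0" if h: "h \<in> Poly_Mapping.lookup ` K" and v: "v \<notin> V" for h v
      proof -
        obtain m where m: "m \<in> K" "h = Poly_Mapping.lookup m" using h by blast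
        then have "v \<notin> Poly_Mapping.keys m" using keys v by blast
        then show ?thesis by (simp add: m(2) in_keys_iff)
      qed
      then show "f = g" using fg by (metis ext)
    qed (use fin True in auto)
    then show ?thesis by (simp add: c_lookup)
  qed (auto simp: K_def in_keys_iff)
  then show "P = ?Q" by (rule poly_mapping_eqI)
qed

theorem theorem2p3:
  fixes p l :: nat and w :: "nat \<Rightarrow> nat list" and k :: "nat \<Rightarrow> nat"
  assumes "prime p"
    and "\<And>i. i \<in> {1..l} \<Longrightarrow> w i \<in> adm_words p"
    and "inj_on w {1..l}"
    and "\<And>i. i \<in> {1..l} \<Longrightarrow> k i > 0"
  shows "Abs_fps (\<lambda>j. Poly_Mapping.lookup (P_poly p j)
             (\<Sum>i = 1..l. Poly_Mapping.single (w i) (k i)))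
       = (\<Prod>i = 1..l. fps_const (1 / fact (k i)) * fps_log (r_word p (w i)) ^ k i)"
proof -
  define m where "m = (\<Sum>i = 1..l. Poly_Mapping.single (w i) (k i))"
  have lookup: "Poly_Mapping.lookup m v = (\<Sum>i = 1..l. if w i = v then k i else 0)" for v
    by (simp add: m_def lookup_sum lookup_single when_def)
  have lookup_w: "Poly_Mapping.lookup m (w i) = k i" if "i \<in> {1..l}" for i
  proof -
    have "Poly_Mapping.lookup m (w i) = (\<Sum>i' = 1..l. if i' = i then k i' else 0)"
      unfolding lookup using inj_on_eq_iff[OF assms(3) _ that] by (intro sum.cong) auto
    then show ?thesis using that by simp
  qed
  have outside: "Poly_Mapping.lookup m v = 0" if "v \<notin> w ` {1..l}" for v
    unfolding lookup using that by (intro sum.neutral) auto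
  \<comment> \<open>Positive exponents keep every given word in the support; distinctness of the
    words has ensured that exponents are not added up.\<close>
  have keys: "Poly_Mapping.keys m = w ` {1..l}"
  proof (intro equalityI subsetI)
    show "v \<in> w ` {1..l}" if "v \<in> Poly_Mapping.keys m" for v
      using that outside[of v] by (auto simp: in_keys_iff)
    show "v \<in> Poly_Mapping.keys m" if "v \<in> w ` {1..l}" for v
      using that lookup_w assms(4) by (auto simp: in_keys_iff)
  qed
  have "Poly_Mapping.keys m \<subseteq> adm_words p" using keys assms(2) by auto
  then have "Abs_fps (\<lambda>j. Poly_Mapping.lookup (P_poly p j) m) = log_monomial p m"
    by (intro fps_ext) (simp add: P_poly_eq_log_poly[OF assms(1)] lookup_log_poly[OF assms(1)])
  also have "\<dots> = (\<Prod>i = 1..l. fps_const (1 / fact (k i)) * fps_log (r_word p (w i)) ^ k i)"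
    unfolding log_monomial_def keys prod.reindex[OF assms(3)]
    by (intro prod.cong) (simp_all add: lookup_w)
  finally show ?thesis unfolding m_def .
qed

end
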